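(* Let $\pi:(M,g,J)\to(N,g_N)$ be a proper bi-slant submersion from a Kähler manifold onto a Riemannian manifold. Assume that each of the subbundles $F\mathcal D^{\theta_1}$ and $F\mathcal D^{\theta_2}$ of $(\ker\pi_* )^\perp$ is locally spanned by basic vector fields. Then $\ker\pi_*$ defines a totally geodesic foliation on $M$ if and only if $$\omega\big(\mathcal T_W PZ+\mathcal A_{FZ}W\big)+F\big(\hat\nabla_W PZ+\mathcal T_W FZ\big)=0$$ for all (local) vertical vector fields $W,Z$ such that $FZ$ is basic.
   Context: All objects are smooth. A Riemannian submersion $\pi:(M,g)\to(N,g_N)$, $\dim M>\dim N$, is a surjective map of maximal rank such that $\pi_*$ restricted to $(\ker\pi_* )^\perp$ is a linear isometry. Vector fields in $\ker\pi_*$ are vertical, those in $(\ker\pi_* )^\perp$ horizontal; $\mathcal V,\mathcal H$ are the orthogonal projections onto $\ker\pi_*$ and $(\ker\pi_* )^\perp$. A horizontal vector field is basic if it is $\pi$-related to a vector field on $N$. $\nabla$ is the Levi-Civita connection of $g$. O'Neill's tensors are $\mathcal T_E G=\mathcal V\nabla_{\mathcal V E}\mathcal H G+\mathcal H\nabla_{\mathcal V E}\mathcal V G$ and $\mathcal A_E G=\mathcal V\nabla_{\mathcal H E}\mathcal H G+\mathcal H\nabla_{\mathcal H E}\mathcal V G$. For vertical $V,W$, $\hat\nabla_V W=\mathcal V\nabla_V W$. Kähler means $J^2=-I$, $g(JX,JY)=g(X,Y)$, $\nabla J=0$. For vertical $V$ write $JV=PV+FV$ with $PV$ vertical and $FV$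 horizontal; for horizontal $\xi$ write $J\xi=\phi\xi+\omega\xi$ with $\phi\xi$ vertical and $\omega\xi$ horizontal. A distribution $\mathcal D$ is slant with slant angle $\theta$ if for every point $p$ and every nonzero $X\in\mathcal D_p$ the angle between $JX$ and $\mathcal D_p$ equals the constant $\theta$. $\pi$ is a bi-slant submersion if $\ker\pi_*=\mathcal D^{\theta_1}\oplus\mathcal D^{\theta_2}$ (orthogonal direct sum), where $\mathcal D^{\theta_i}$ is slant with slant angle $\theta_i$ and $P\mathcal D^{\theta_i}\subset\mathcal D^{\theta_i}$, $i=1,2$. It is proper if neither slant angle is $0$ or $\pi/2$, i.e. $\theta_1,\theta_2\in(0,\pi/2)$. A distribution $\mathcal D$ on $M$ defines a totally geodesic foliation if $\nabla_X Y\in\mathcal D$ for all vector fields $X,Y\in\mathcal D$. *)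

theory Defs
  imports "HOL-Analysis.Analysis"
begin

section \<open>Smooth manifolds\<close>

primrec Ck_on :: "nat \<Rightarrow> 'e::real_normed_vector set \<Rightarrow> ('e \<Rightarrow> 'f::real_normed_vector) \<Rightarrow> bool" where
  "Ck_on 0 S f \<longleftrightarrow> continuous_on S f"
| "Ck_on (Suc k) S f \<longleftrightarrow>
     (\<forall>x\<in>S. f differentiable (at x)) \<and> (\<forall>v. Ck_on k S (\<lambda>x. frechet_derivative f (at x) v))"

text \<open>Only used for open \<open>S\<close> in a finite-dimensional space, where continuity of all iterated
  directional derivatives is the usual notion.\<close>

definition smooth_on :: "'e::real_normed_vector set \<Rightarrow> ('e \<Rightarrow> 'f::real_normed_vector) \<Rightarrow> bool" where
  "smooth_on S f \<longleftrightarrow> (\<forall>k. Ck_on k S f)"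

type_synonym ('m, 'e) atlas = "('m set \<times> ('m \<Rightarrow> 'e)) set"

text \<open>The manifold is the whole type \<open>'m\<close>; its dimension is \<open>dim (UNIV :: 'e set)\<close>.  The model
  space is a finite-dimensional inner product space rather than a \<open>euclidean_space\<close> because the
  latter class excludes dimension 0.\<close>

definition smooth_atlas ::
    "('m::{t2_space,second_countable_topology}, 'e::real_inner) atlas \<Rightarrow> bool" where
  "smooth_atlas A \<longleftrightarrow>
     (\<exists>B. finite B \<and> span B = (UNIV :: 'e set)) \<and>
     (\<Union>(U, \<phi>)\<in>A. U) = UNIV \<and>
     (\<forall>(U, \<phi>)\<in>A. open U \<and> open (\<phi> ` U) \<and> homeomorphism U (\<phi> ` U) \<phi> (inv_into U \<phi>)) \<and>
     (\<forall>(U, \<phi>)\<in>A. \<forall>(V, \<psi>)\<in>A. smooth_on (\<phi> ` (U \<inter> V)) (\<psi> \<circ> inv_into U \<phi>))"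

definition smooth_fun :: "('m::topological_space, 'e::real_inner) atlas \<Rightarrow> 'm set \<Rightarrow> ('m \<Rightarrow> real) \<Rightarrow> bool" where
  "smooth_fun A W f \<longleftrightarrow> (\<forall>(U, \<phi>)\<in>A. smooth_on (\<phi> ` (U \<inter> W)) (f \<circ> inv_into U \<phi>))"

definition smooth_near :: "('m::topological_space, 'e::real_inner) atlas \<Rightarrow> 'm \<Rightarrow> ('m \<Rightarrow> real) \<Rightarrow> bool" where
  "smooth_near A p f \<longleftrightarrow> (\<exists>W. open W \<and> p \<in> W \<and> smooth_fun A W f)"

definition smooth_map ::
    "('m::topological_space, 'e::real_inner) atlas \<Rightarrow> ('n::topological_space, 'f::real_inner) atlas
      \<Rightarrow> ('m \<Rightarrow> 'n) \<Rightarrow> bool" where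
  "smooth_map A B \<pi> \<longleftrightarrow> continuous_on UNIV \<pi> \<and>
     (\<forall>(U, \<phi>)\<in>A. \<forall>(V, \<psi>)\<in>B. smooth_on (\<phi> ` (U \<inter> \<pi> -` V)) (\<psi> \<circ> \<pi> \<circ> inv_into U \<phi>))"


section \<open>Tangent vectors and vector fields\<close>

text \<open>Real-valued functionals on functions, as a real vector space; the tangent spaces are
  subspaces of this type.\<close>

typedef 'm tvec = "UNIV :: (('m \<Rightarrow> real) \<Rightarrow> real) set"
  morphisms tapp Tvec by simp

lemma tapp_Tvec [simp]: "tapp (Tvec F) = F"
  by (simp add: Tvec_inverse)

lemma tvec_eqI: "(\<And>f. tapp v f = tapp w f) \<Longrightarrow> v = w"
  by (simp add: tapp_inject[symmetric] fun_eq_iff)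

instantiation tvec :: (type) real_vector
begin

definition "0 = Tvec (\<lambda>f. 0)"
definition "v + w = Tvec (\<lambda>f. tapp v f + tapp w f)"
definition "- v = Tvec (\<lambda>f. - tapp v f)"
definition "v - w = Tvec (\<lambda>f. tapp v f - tapp w f)"
definition "c *\<^sub>R v = Tvec (\<lambda>f. c * tapp v f)"

instance
  by standard
    (auto intro!: tvec_eqI simp: zero_tvec_def plus_tvec_def uminus_tvec_def minus_tvec_def
      scaleR_tvec_def algebra_simps)

end

lemma tapp_simps [simp]:
  "tapp 0 f = 0"
  "tapp (v + w) f = tapp v f + tapp w f"
  "tapp (- v) f = - tapp v f"
  "tapp (v - w) f = tapp v f - tapp w f"
  "tapp (c *\<^sub>R v) f = c * tapp v f"
  by (simp_all add: zero_tvec_def plus_tvec_def uminus_tvec_def minus_tvec_def scaleR_tvec_def)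

text \<open>Derivations of the algebra of germs at \<open>p\<close> of smooth functions.  Germs are represented by total
  functions; the last clause fixes the value on functions that are not smooth near \<open>p\<close>, so that
  distinct elements are distinct derivations.\<close>

definition tangent_space :: "('m::topological_space, 'e::real_inner) atlas \<Rightarrow> 'm \<Rightarrow> 'm tvec set" where
  "tangent_space A p = {v.
     (\<forall>f g. smooth_near A p f \<and> smooth_near A p g \<longrightarrow>
        tapp v (\<lambda>x. f x + g x) = tapp v f + tapp v g \<and>
        tapp v (\<lambda>x. f x * g x) = tapp v f * g p + f p * tapp v g) \<and>
     (\<forall>f c. smooth_near A p f \<longrightarrow> tapp v (\<lambda>x. c * f x) = c * tapp v f) \<and>
     (\<forall>f g. smooth_near A p f \<and> smooth_near A p g \<and> eventually (\<lambda>x. f x = g x) (nhds p)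
        \<longrightarrow> tapp v f = tapp v g) \<and>
     (\<forall>f. \<not> smooth_near A p f \<longrightarrow> tapp v f = 0)}"

definition pushforward ::
    "('n::topological_space, 'f::real_inner) atlas \<Rightarrow> ('m \<Rightarrow> 'n) \<Rightarrow> 'm \<Rightarrow> 'm tvec \<Rightarrow> 'n tvec" where
  "pushforward B \<pi> p v = Tvec (\<lambda>f. if smooth_near B (\<pi> p) f then tapp v (f \<circ> \<pi>) else 0)"

text \<open>Vector fields on an open set \<open>U\<close> are total functions whose values outside \<open>U\<close> are irrelevant.\<close>

definition vector_field ::
    "('m::topological_space, 'e::real_inner) atlas \<Rightarrow> 'm set \<Rightarrow> ('m \<Rightarrow> 'm tvec) \<Rightarrow> bool" where
  "vector_field A U X \<longleftrightarrow> (\<forall>p\<in>U. X p \<in> tangent_space A p) \<and>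
     (\<forall>V f. open V \<and> V \<subseteq> U \<and> smooth_fun A V f \<longrightarrow> smooth_fun A V (\<lambda>p. tapp (X p) f))"

definition vector_field_near ::
    "('m::topological_space, 'e::real_inner) atlas \<Rightarrow> 'm \<Rightarrow> ('m \<Rightarrow> 'm tvec) \<Rightarrow> bool" where
  "vector_field_near A p X \<longleftrightarrow> (\<exists>U. open U \<and> p \<in> U \<and> vector_field A U X)"

definition lie_bracket ::
    "('m::topological_space, 'e::real_inner) atlas \<Rightarrow> ('m \<Rightarrow> 'm tvec) \<Rightarrow> ('m \<Rightarrow> 'm tvec)
      \<Rightarrow> 'm \<Rightarrow> 'm tvec" where
  "lie_bracket A X Y p = Tvec (\<lambda>f. if smooth_near A p f
     then tapp (X p) (\<lambda>q. tapp (Y q) f) - tapp (Y p) (\<lambda>q. tapp (X q) f) else 0)"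


section \<open>Riemannian metrics, the Levi-Civita connection and Kaehler structures\<close>

type_synonym 'm metric_tensor = "'m \<Rightarrow> 'm tvec \<Rightarrow> 'm tvec \<Rightarrow> real"

definition riemannian_manifold ::
    "('m::{t2_space,second_countable_topology}, 'e::real_inner) atlas \<Rightarrow> 'm metric_tensor \<Rightarrow> bool" where
  "riemannian_manifold A g \<longleftrightarrow> smooth_atlas A \<and>
     (\<forall>p. \<forall>u\<in>tangent_space A p. \<forall>v\<in>tangent_space A p.
        g p u v = g p v u \<and> (u \<noteq> 0 \<longrightarrow> g p u u > 0) \<and>
        (\<forall>w\<in>tangent_space A p. \<forall>a b. g p (a *\<^sub>R u + b *\<^sub>R v) w = a * g p u w + b * g p v w)) \<and>
     (\<forall>U X Y. open U \<and> vector_field A U X \<and> vector_field A U Y \<longrightarrow>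
        smooth_fun A U (\<lambda>p. g p (X p) (Y p)))"

text \<open>\<open>nabla p v Y\<close> is the covariant derivative at \<open>p\<close>, in direction \<open>v\<close>, of a vector field \<open>Y\<close>
  defined near \<open>p\<close>; thus \<open>\<nabla>\<^sub>X Y\<close> is \<open>\<lambda>p. nabla p (X p) Y\<close>.\<close>

type_synonym 'm connection = "'m \<Rightarrow> 'm tvec \<Rightarrow> ('m \<Rightarrow> 'm tvec) \<Rightarrow> 'm tvec"

definition affine_connection ::
    "('m::topological_space, 'e::real_inner) atlas \<Rightarrow> 'm connection \<Rightarrow> bool" where
  "affine_connection A nabla \<longleftrightarrow>
     (\<forall>p Y. vector_field_near A p Y \<longrightarrow>
        (\<forall>v\<in>tangent_space A p. nabla p v Y \<in> tangent_space A p \<and>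
          (\<forall>w\<in>tangent_space A p. \<forall>a b.
             nabla p (a *\<^sub>R v + b *\<^sub>R w) Y = a *\<^sub>R nabla p v Y + b *\<^sub>R nabla p w Y) \<and>
          (\<forall>f. smooth_near A p f \<longrightarrow>
             nabla p v (\<lambda>q. f q *\<^sub>R Y q) = tapp v f *\<^sub>R Y p + f p *\<^sub>R nabla p v Y) \<and>
          (\<forall>Z. vector_field_near A p Z \<longrightarrow>
             nabla p v (\<lambda>q. Y q + Z q) = nabla p v Y + nabla p v Z \<and>
             (eventually (\<lambda>q. Y q = Z q) (nhds p) \<longrightarrow> nabla p v Y = nabla p v Z)))) \<and>
     (\<forall>U X Y. open U \<and> vector_field A U X \<and> vector_field A U Y \<longrightarrow>
        vector_field A U (\<lambda>p. nabla p (X p) Y))"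

definition levi_civita ::
    "('m::topological_space, 'e::real_inner) atlas \<Rightarrow> 'm metric_tensor \<Rightarrow> 'm connection \<Rightarrow> bool" where
  "levi_civita A g nabla \<longleftrightarrow> affine_connection A nabla \<and>
     (\<forall>p Y Z. vector_field_near A p Y \<and> vector_field_near A p Z \<longrightarrow>
        nabla p (Y p) Z - nabla p (Z p) Y = lie_bracket A Y Z p \<and>
        (\<forall>v\<in>tangent_space A p.
           tapp v (\<lambda>q. g q (Y q) (Z q)) = g p (nabla p v Y) (Z p) + g p (Y p) (nabla p v Z)))"

text \<open>\<open>nabla\<close> is meant to be the Levi-Civita connection of \<open>g\<close>.\<close>

definition kaehler ::
    "('m::topological_space, 'e::real_inner) atlas \<Rightarrow> 'm metric_tensor \<Rightarrow> 'm connection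
      \<Rightarrow> ('m \<Rightarrow> 'm tvec \<Rightarrow> 'm tvec) \<Rightarrow> bool" where
  "kaehler A g nabla J \<longleftrightarrow>
     (\<forall>p. \<forall>u\<in>tangent_space A p. J p u \<in> tangent_space A p \<and> J p (J p u) = - u \<and>
        (\<forall>v\<in>tangent_space A p. g p (J p u) (J p v) = g p u v \<and>
           (\<forall>a b. J p (a *\<^sub>R u + b *\<^sub>R v) = a *\<^sub>R J p u + b *\<^sub>R J p v))) \<and>
     (\<forall>U X. open U \<and> vector_field A U X \<longrightarrow> vector_field A U (\<lambda>p. J p (X p))) \<and>
     (\<forall>p Y. vector_field_near A p Y \<longrightarrow>
        (\<forall>v\<in>tangent_space A p. nabla p v (\<lambda>q. J q (Y q)) = J p (nabla p v Y)))"


section \<open>Distributions and orthogonal projections\<close>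

definition distribution ::
    "('m::topological_space, 'e::real_inner) atlas \<Rightarrow> ('m \<Rightarrow> 'm tvec set) \<Rightarrow> bool" where
  "distribution A D \<longleftrightarrow> (\<exists>k::nat. \<forall>p. \<exists>U X. open U \<and> p \<in> U \<and>
     (\<forall>i<k. vector_field A U (X i)) \<and>
     (\<forall>q\<in>U. inj_on (\<lambda>i. X i q) {..<k} \<and> independent ((\<lambda>i. X i q) ` {..<k}) \<and>
        D q = span ((\<lambda>i. X i q) ` {..<k})))"

definition section_on ::
    "('m::topological_space, 'e::real_inner) atlas \<Rightarrow> 'm set \<Rightarrow> ('m \<Rightarrow> 'm tvec set)
      \<Rightarrow> ('m \<Rightarrow> 'm tvec) \<Rightarrow> bool" where
  "section_on A U D X \<longleftrightarrow> vector_field A U X \<and> (\<forall>p\<in>U. X p \<in> D p)"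

definition totally_geodesic_foliation ::
    "('m::topological_space, 'e::real_inner) atlas \<Rightarrow> 'm connection \<Rightarrow> ('m \<Rightarrow> 'm tvec set) \<Rightarrow> bool" where
  "totally_geodesic_foliation A nabla D \<longleftrightarrow>
     (\<forall>U X Y. open U \<and> section_on A U D X \<and> section_on A U D Y \<longrightarrow>
        (\<forall>p\<in>U. nabla p (X p) Y \<in> D p))"

definition orth_compl ::
    "('m::topological_space, 'e::real_inner) atlas \<Rightarrow> 'm metric_tensor \<Rightarrow> ('m \<Rightarrow> 'm tvec set)
      \<Rightarrow> 'm \<Rightarrow> 'm tvec set" where
  "orth_compl A g K p = {v \<in> tangent_space A p. \<forall>w\<in>K p. g p v w = 0}"

definition orth_proj :: "'m metric_tensor \<Rightarrow> ('m \<Rightarrow> 'm tvec set) \<Rightarrow> 'm \<Rightarrow> 'm tvec \<Rightarrow> 'm tvec" where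
  "orth_proj g D p e = (THE v. v \<in> D p \<and> (\<forall>w\<in>D p. g p (e - v) w = 0))"

text \<open>The least angle between the vector \<open>u\<close> and a nonzero vector of \<open>D p\<close>.\<close>

definition angle_to :: "'m metric_tensor \<Rightarrow> ('m \<Rightarrow> 'm tvec set) \<Rightarrow> 'm \<Rightarrow> 'm tvec \<Rightarrow> real" where
  "angle_to g D p u =
     Inf {arccos (g p u w / (sqrt (g p u u) * sqrt (g p w w))) | w. w \<in> D p \<and> w \<noteq> 0}"

definition slant ::
    "'m metric_tensor \<Rightarrow> ('m \<Rightarrow> 'm tvec \<Rightarrow> 'm tvec) \<Rightarrow> ('m \<Rightarrow> 'm tvec set) \<Rightarrow> real \<Rightarrow> bool" where
  "slant g J D \<theta> \<longleftrightarrow> (\<forall>p. \<forall>X\<in>D p. X \<noteq> 0 \<longrightarrow> angle_to g D p (J p X) = \<theta>)"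


section \<open>Riemannian submersions\<close>

definition vertical ::
    "('m::topological_space, 'e::real_inner) atlas \<Rightarrow> ('n::topological_space, 'f::real_inner) atlas
      \<Rightarrow> ('m \<Rightarrow> 'n) \<Rightarrow> 'm \<Rightarrow> 'm tvec set" where
  "vertical A B \<pi> p = {v \<in> tangent_space A p. pushforward B \<pi> p v = 0}"

definition riemannian_submersion ::
    "('m::{t2_space,second_countable_topology}, 'e::real_inner) atlas \<Rightarrow> 'm metric_tensor
      \<Rightarrow> ('n::{t2_space,second_countable_topology}, 'f::real_inner) atlas \<Rightarrow> 'n metric_tensor
      \<Rightarrow> ('m \<Rightarrow> 'n) \<Rightarrow> bool" where
  "riemannian_submersion A g B gN \<pi> \<longleftrightarrow>
     dim (UNIV :: 'e set) > dim (UNIV :: 'f set) \<and> smooth_map A B \<pi> \<and> surj \<pi> \<and>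
     (\<forall>p. pushforward B \<pi> p ` tangent_space A p = tangent_space B (\<pi> p)) \<and>
     (\<forall>p. \<forall>u\<in>orth_compl A g (vertical A B \<pi>) p. \<forall>v\<in>orth_compl A g (vertical A B \<pi>) p.
        gN (\<pi> p) (pushforward B \<pi> p u) (pushforward B \<pi> p v) = g p u v)"

text \<open>The field on the base is only required near \<open>\<pi> ` U\<close> (which is open for a submersion).\<close>

definition basic_on ::
    "('m::topological_space, 'e::real_inner) atlas \<Rightarrow> 'm metric_tensor
      \<Rightarrow> ('n::topological_space, 'f::real_inner) atlas \<Rightarrow> ('m \<Rightarrow> 'n) \<Rightarrow> 'm set \<Rightarrow> ('m \<Rightarrow> 'm tvec) \<Rightarrow> bool" where
  "basic_on A g B \<pi> U X \<longleftrightarrow> section_on A U (orth_compl A g (vertical A B \<pi>)) X \<and>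
     (\<exists>V Y. open V \<and> \<pi> ` U \<subseteq> V \<and> vector_field B V Y \<and> (\<forall>p\<in>U. pushforward B \<pi> p (X p) = Y (\<pi> p)))"

definition locally_spanned_by_basic ::
    "('m::topological_space, 'e::real_inner) atlas \<Rightarrow> 'm metric_tensor
      \<Rightarrow> ('n::topological_space, 'f::real_inner) atlas \<Rightarrow> ('m \<Rightarrow> 'n) \<Rightarrow> ('m \<Rightarrow> 'm tvec set) \<Rightarrow> bool" where
  "locally_spanned_by_basic A g B \<pi> E \<longleftrightarrow>
     (\<forall>p. \<exists>U \<Xi>. open U \<and> p \<in> U \<and> finite \<Xi> \<and> (\<forall>\<xi>\<in>\<Xi>. basic_on A g B \<pi> U \<xi>) \<and>
        (\<forall>q\<in>U. E q = span ((\<lambda>\<xi>. \<xi> q) ` \<Xi>)))"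

text \<open>In the following, \<open>K\<close> is the vertical distribution of the submersion.\<close>

definition ver_proj :: "'m metric_tensor \<Rightarrow> ('m \<Rightarrow> 'm tvec set) \<Rightarrow> 'm \<Rightarrow> 'm tvec \<Rightarrow> 'm tvec" where
  "ver_proj g K = orth_proj g K"

definition hor_proj ::
    "('m::topological_space, 'e::real_inner) atlas \<Rightarrow> 'm metric_tensor \<Rightarrow> ('m \<Rightarrow> 'm tvec set)
      \<Rightarrow> 'm \<Rightarrow> 'm tvec \<Rightarrow> 'm tvec" where
  "hor_proj A g K = orth_proj g (orth_compl A g K)"

definition oneill_T ::
    "('m::topological_space, 'e::real_inner) atlas \<Rightarrow> 'm metric_tensor \<Rightarrow> 'm connection
      \<Rightarrow> ('m \<Rightarrow> 'm tvec set) \<Rightarrow> ('m \<Rightarrow> 'm tvec) \<Rightarrow> ('m \<Rightarrow> 'm tvec) \<Rightarrow> 'm \<Rightarrow> 'm tvec" where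
  "oneill_T A g nabla K E G p =
     ver_proj g K p (nabla p (ver_proj g K p (E p)) (\<lambda>q. hor_proj A g K q (G q))) +
     hor_proj A g K p (nabla p (ver_proj g K p (E p)) (\<lambda>q. ver_proj g K q (G q)))"

definition oneill_A ::
    "('m::topological_space, 'e::real_inner) atlas \<Rightarrow> 'm metric_tensor \<Rightarrow> 'm connection
      \<Rightarrow> ('m \<Rightarrow> 'm tvec set) \<Rightarrow> ('m \<Rightarrow> 'm tvec) \<Rightarrow> ('m \<Rightarrow> 'm tvec) \<Rightarrow> 'm \<Rightarrow> 'm tvec" where
  "oneill_A A g nabla K E G p =
     ver_proj g K p (nabla p (hor_proj A g K p (E p)) (\<lambda>q. hor_proj A g K q (G q))) +
     hor_proj A g K p (nabla p (hor_proj A g K p (E p)) (\<lambda>q. ver_proj g K q (G q)))"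

definition nabla_hat ::
    "'m metric_tensor \<Rightarrow> 'm connection \<Rightarrow> ('m \<Rightarrow> 'm tvec set) \<Rightarrow> ('m \<Rightarrow> 'm tvec) \<Rightarrow> ('m \<Rightarrow> 'm tvec)
      \<Rightarrow> 'm \<Rightarrow> 'm tvec" where
  "nabla_hat g nabla K V W p = ver_proj g K p (nabla p (V p) W)"

text \<open>\<open>J_ver\<close> is \<open>P\<close> on vertical and \<open>\<phi>\<close> on horizontal vectors; \<open>J_hor\<close> is \<open>F\<close> on vertical and
  \<open>\<omega>\<close> on horizontal vectors.\<close>

definition J_ver ::
    "'m metric_tensor \<Rightarrow> ('m \<Rightarrow> 'm tvec set) \<Rightarrow> ('m \<Rightarrow> 'm tvec \<Rightarrow> 'm tvec) \<Rightarrow> 'm \<Rightarrow> 'm tvec \<Rightarrow> 'm tvec" where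
  "J_ver g K J p v = ver_proj g K p (J p v)"

definition J_hor ::
    "('m::topological_space, 'e::real_inner) atlas \<Rightarrow> 'm metric_tensor \<Rightarrow> ('m \<Rightarrow> 'm tvec set)
      \<Rightarrow> ('m \<Rightarrow> 'm tvec \<Rightarrow> 'm tvec) \<Rightarrow> 'm \<Rightarrow> 'm tvec \<Rightarrow> 'm tvec" where
  "J_hor A g K J p v = hor_proj A g K p (J p v)"

text \<open>The sum is automatically direct, since \<open>D1\<close> and \<open>D2\<close> are orthogonal.\<close>

definition bi_slant ::
    "('m::topological_space, 'e::real_inner) atlas \<Rightarrow> 'm metric_tensor
      \<Rightarrow> ('m \<Rightarrow> 'm tvec \<Rightarrow> 'm tvec) \<Rightarrow> ('m \<Rightarrow> 'm tvec set)
      \<Rightarrow> ('m \<Rightarrow> 'm tvec set) \<Rightarrow> real \<Rightarrow> ('m \<Rightarrow> 'm tvec set) \<Rightarrow> real \<Rightarrow> bool" where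
  "bi_slant A g J K D1 \<theta>1 D2 \<theta>2 \<longleftrightarrow>
     distribution A D1 \<and> distribution A D2 \<and>
     (\<forall>p. K p = {x + y | x y. x \<in> D1 p \<and> y \<in> D2 p} \<and> (\<forall>x\<in>D1 p. \<forall>y\<in>D2 p. g p x y = 0)) \<and>
     slant g J D1 \<theta>1 \<and> slant g J D2 \<theta>2 \<and>
     (\<forall>p. J_ver g K J p ` D1 p \<subseteq> D1 p \<and> J_ver g K J p ` D2 p \<subseteq> D2 p)"

end

theory Submission
  imports Defs
begin

text \<open>Since \<open>J\<close> is parallel, \<open>J \<nabla>\<^sub>W Z = \<nabla>\<^sub>W PZ + \<nabla>\<^sub>W FZ\<close> for vertical \<open>W\<close>, \<open>Z\<close>.  If \<open>FZ\<close> is basic, then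
  \<open>[W, FZ]\<close> is vertical, so \<open>\<H> \<nabla>\<^sub>W FZ = \<A>\<^bsub>FZ\<^esub> W\<close>; applying \<open>J\<close> once more and taking horizontal parts
  identifies the expression of the theorem with \<open>- \<H> \<nabla>\<^sub>W Z\<close>.  This settles one direction.  For the
  converse let \<open>N = \<H> \<nabla>\<^sub>X Y\<close> with \<open>X\<close>, \<open>Y\<close> vertical.  Then \<open>g(N, N) = - g(Y, \<nabla>\<^sub>X N)\<close> depends on
  \<open>Y\<close> only pointwise, and \<open>g(Z, \<nabla>\<^sub>X N) = - g(\<nabla>\<^sub>X Z, N) = 0\<close> whenever \<open>FZ\<close> is basic.  Such \<open>Z\<close> span
  the vertical space, because \<open>\<phi>F = - sin\<^sup>2 \<theta>\<^sub>i\<close> on \<open>D\<^sub>i\<close> turns a basic field \<open>\<xi>\<close> in \<open>FD\<^sub>i\<close> into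
  \<open>Z = - \<phi>\<xi> / sin\<^sup>2 \<theta>\<^sub>i\<close> with \<open>FZ = \<xi>\<close>.\<close>

section \<open>Smooth functions\<close>

text \<open>Openness of \<open>S\<close> makes the derivative at a point of \<open>S\<close> depend
  only on values inside \<open>S\<close>. The induction passes from \<open>f\<close> and
  \<open>h\<close> to their directional derivatives, hence both are generalised.\<close>

lemma Ck_on_cong:
  fixes f h :: "'e::real_normed_vector \<Rightarrow> 'f::real_normed_vector"
  assumes "open S" "\<And>x. x \<in> S \<Longrightarrow> f x = h x" "Ck_on k S f"
  shows "Ck_on k S h"
  using assms(2,3)
proof (induction k arbitrary: f h)
  case 0
  then show ?case by (auto cong: continuous_on_cong)
next
  case (Suc k)
  have D: "(h has_derivative frechet_derivative f (at x)) (at x)" if "x \<in> S" for x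
  proof -
    have "(f has_derivative frechet_derivative f (at x)) (at x)"
      using Suc.prems(2) that by (simp add: frechet_derivative_works)
    then show ?thesis
      using has_derivative_transform_within_open[OF _ \<open>open S\<close> that] Suc.prems(1) by blast
  qed
  show ?case
    unfolding Ck_on.simps
  proof (intro conjI ballI allI)
    show "h differentiable at x" if "x \<in> S" for x
      using D[OF that] by (auto simp: differentiable_def)
    fix v
    show "Ck_on k S (\<lambda>x. frechet_derivative h (at x) v)"
      by (rule Suc.IH[where f = "\<lambda>x. frechet_derivative f (at x) v"])
        (use frechet_derivative_at[OF D] Suc.prems(2) in auto)
  qed
qed

lemma Ck_on_mono: "Ck_on k S f \<Longrightarrow> R \<subseteq> S \<Longrightarrow> Ck_on k R f"
  by (induction k arbitrary: f) (auto intro: continuous_on_subset)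

text \<open>The successor clause of \<open>Ck_on\<close> speaks only of derivatives, so continuity
  of \<open>f\<close> itself has to be recovered, in the base case, from differentiability.\<close>

lemma Ck_on_SucD: "Ck_on (Suc k) S f \<Longrightarrow> Ck_on k S f"
proof (induction k arbitrary: f)
  case 0
  then show ?case
    by (auto intro!: continuous_at_imp_continuous_on differentiable_imp_continuous_within)
qed auto

lemma Ck_on_const [simp]: "Ck_on k S (\<lambda>x. c)"
  by (induction k arbitrary: c) (auto simp: frechet_derivative_const)

text \<open>By uniqueness of derivatives, any explicitly known derivative may replace
  \<open>frechet_derivative\<close>; the sum, product and reciprocal rules then enter the inductions
  below directly.\<close>

lemma Ck_on_SucI:
  fixes f :: "'e::real_normed_vector \<Rightarrow> 'f::real_normed_vector"
  assumes "open S" "\<And>x. x \<in> S \<Longrightarrow> (f has_derivative f' x) (at x)"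
    and "\<And>v. Ck_on k S (\<lambda>x. f' x v)"
  shows "Ck_on (Suc k) S f"
proof -
  have "frechet_derivative f (at x) = f' x" if "x \<in> S" for x
    using assms(2)[OF that] by (simp flip: frechet_derivative_at)
  then have "Ck_on k S (\<lambda>x. frechet_derivative f (at x) v)" for v
    using Ck_on_cong[OF assms(1) _ assms(3)[of v], of "\<lambda>x. frechet_derivative f (at x) v"] by simp
  then show ?thesis
    using assms(2) by (auto simp: differentiable_def)
qed

lemma Ck_on_SucD_derivative:
  "Ck_on (Suc k) S f \<Longrightarrow> x \<in> S \<Longrightarrow> (f has_derivative frechet_derivative f (at x)) (at x)"
  by (simp add: frechet_derivative_works)

lemma Ck_on_add:
  fixes f h :: "'e::real_normed_vector \<Rightarrow> 'f::real_normed_vector"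
  assumes "open S" "Ck_on k S f" "Ck_on k S h"
  shows "Ck_on k S (\<lambda>x. f x + h x)"
  using assms(2,3)
proof (induction k arbitrary: f h)
  case 0
  then show ?case by (simp add: continuous_on_add)
next
  case (Suc k)
  show ?case
    by (rule Ck_on_SucI[OF \<open>open S\<close>
          has_derivative_add[OF Ck_on_SucD_derivative[OF Suc.prems(1)] Ck_on_SucD_derivative[OF Suc.prems(2)]]])
      (use Suc in auto)
qed

lemma Ck_on_mult:
  fixes f h :: "'e::real_normed_vector \<Rightarrow> real"
  assumes "open S" "Ck_on k S f" "Ck_on k S h"
  shows "Ck_on k S (\<lambda>x. f x * h x)"
  using assms(2,3)
proof (induction k arbitrary: f h)
  case 0
  then show ?case by (simp add: continuous_on_mult)
next
  case (Suc k)
  show ?case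
  proof (rule Ck_on_SucI[OF \<open>open S\<close>
          has_derivative_mult[OF Ck_on_SucD_derivative[OF Suc.prems(1)] Ck_on_SucD_derivative[OF Suc.prems(2)]]])
    fix v
    \<comment> \<open>The Leibniz terms contain \<open>f\<close> and \<open>h\<close>
      undifferentiated, so for the induction hypothesis both are lowered from order
      \<open>Suc k\<close> to order \<open>k\<close>.\<close>
    show "Ck_on k S (\<lambda>x. f x * frechet_derivative h (at x) v + frechet_derivative f (at x) v * h x)"
      using Suc.prems Ck_on_SucD[OF Suc.prems(1)] Ck_on_SucD[OF Suc.prems(2)]
      by (intro Ck_on_add[OF \<open>open S\<close>] Suc.IH) auto
  qed
qed

lemma Ck_on_inverse:
  fixes f :: "'e::real_normed_vector \<Rightarrow> real"
  assumes "open S" "Ck_on k S f" "\<And>x. x \<in> S \<Longrightarrow> f x \<noteq> 0"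
  shows "Ck_on k S (\<lambda>x. inverse (f x))"
  using assms(2)
proof (induction k)
  case 0
  then show ?case using assms(3) by (auto intro: continuous_on_inverse)
next
  case (Suc k)
  show ?case
  proof (rule Ck_on_SucI[OF \<open>open S\<close>
          Deriv.has_derivative_inverse[OF assms(3) Ck_on_SucD_derivative[OF Suc.prems]]])
    fix v
    \<comment> \<open>Writing the sign as a constant factor makes this a product; the two
      reciprocals in it fall under the induction hypothesis.\<close>
    have "Ck_on k S (\<lambda>x. (- 1) * (inverse (f x) * frechet_derivative f (at x) v * inverse (f x)))"
      using Suc.prems Ck_on_SucD[OF Suc.prems]
      by (intro Ck_on_mult[OF \<open>open S\<close>] Suc.IH) auto
    then show "Ck_on k S (\<lambda>x. - (inverse (f x) * frechet_derivative f (at x) v * inverse (f x)))"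
      by simp
  qed
qed

section \<open>Smooth functions on a manifold, read in charts\<close>

lemma open_chart_image:
  assumes "smooth_atlas A" "(U, \<phi>) \<in> A" "open W"
  shows "open (\<phi> ` (U \<inter> W))"
proof -
  have *: "open U" "open (\<phi> ` U)" "homeomorphism U (\<phi> ` U) \<phi> (inv_into U \<phi>)"
    using assms(1,2) unfolding smooth_atlas_def by auto
  have "openin (top_of_set U) (U \<inter> W)"
    using assms(3) by (simp add: openin_open_Int)
  from homeomorphism_imp_open_map[OF *(3) this] show ?thesis
    using *(2) openin_open_eq by blast
qed

lemma inv_into_chart:
  assumes "smooth_atlas A" "(U, \<phi>) \<in> A" "x \<in> U"
  shows "inv_into U \<phi> (\<phi> x) = x"
proof -
  have "homeomorphism U (\<phi> ` U) \<phi> (inv_into U \<phi>)"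
    using assms(1,2) unfolding smooth_atlas_def by auto
  then show ?thesis using assms(3) by (simp add: homeomorphism_def)
qed

lemma smooth_fun_mono: "smooth_fun A W f \<Longrightarrow> W' \<subseteq> W \<Longrightarrow> smooth_fun A W' f"
  unfolding smooth_fun_def smooth_on_def by (fastforce intro: Ck_on_mono)

lemma smooth_fun_const [simp]: "smooth_fun A W (\<lambda>x. c)"
  unfolding smooth_fun_def smooth_on_def by (auto simp: comp_def)

context
  fixes A :: "('m::{t2_space,second_countable_topology}, 'e::real_inner) atlas"
  assumes A: "smooth_atlas A"
begin

lemma smooth_fun_cong:
  assumes "open W" "\<And>x. x \<in> W \<Longrightarrow> f x = h x" "smooth_fun A W f"
  shows "smooth_fun A W h"
  unfolding smooth_fun_def smooth_on_def
proof (clarify)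
  fix U \<phi> k assume U: "(U, \<phi>) \<in> A"
  then have "Ck_on k (\<phi> ` (U \<inter> W)) (f \<circ> inv_into U \<phi>)"
    using assms(3) by (auto simp: smooth_fun_def smooth_on_def)
  then show "Ck_on k (\<phi> ` (U \<inter> W)) (h \<circ> inv_into U \<phi>)"
    by (rule Ck_on_cong[OF open_chart_image[OF A U assms(1)], rotated])
      (auto simp: inv_into_chart[OF A U] assms(2))
qed

lemma smooth_fun_add:
  "open W \<Longrightarrow> smooth_fun A W f \<Longrightarrow> smooth_fun A W h \<Longrightarrow> smooth_fun A W (\<lambda>x. f x + h x)"
  unfolding smooth_fun_def smooth_on_def
  by (fastforce simp: comp_def intro: Ck_on_add[OF open_chart_image[OF A]])

lemma smooth_fun_mult:
  "open W \<Longrightarrow> smooth_fun A W f \<Longrightarrow> smooth_fun A W h \<Longrightarrow> smooth_fun A W (\<lambda>x. f x * h x)"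
  unfolding smooth_fun_def smooth_on_def
  by (fastforce simp: comp_def intro: Ck_on_mult[OF open_chart_image[OF A]])

lemma smooth_fun_inverse:
  assumes "open W" "smooth_fun A W f" "\<And>x. x \<in> W \<Longrightarrow> f x \<noteq> 0"
  shows "smooth_fun A W (\<lambda>x. inverse (f x))"
  unfolding smooth_fun_def smooth_on_def
proof (clarify)
  fix U \<phi> k assume U: "(U, \<phi>) \<in> A"
  then have *: "Ck_on k (\<phi> ` (U \<inter> W)) (\<lambda>x. f (inv_into U \<phi> x))"
    using assms(2) by (auto simp: smooth_fun_def smooth_on_def comp_def)
  have "f (inv_into U \<phi> x) \<noteq> 0" if "x \<in> \<phi> ` (U \<inter> W)" for x
    using that by (auto simp: inv_into_chart[OF A U] assms(3))
  from Ck_on_inverse[OF open_chart_image[OF A U assms(1)] * this]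
  show "Ck_on k (\<phi> ` (U \<inter> W)) ((\<lambda>x. inverse (f x)) \<circ> inv_into U \<phi>)"
    by (simp add: comp_def)
qed

lemma smooth_nearI: "open W \<Longrightarrow> p \<in> W \<Longrightarrow> smooth_fun A W f \<Longrightarrow> smooth_near A p f"
  unfolding smooth_near_def by blast

lemma smooth_near_const [simp]: "smooth_near A p (\<lambda>x. c)"
  by (rule smooth_nearI[of UNIV]) auto

lemma smooth_near_cong:
  assumes "smooth_near A p f" "eventually (\<lambda>x. f x = h x) (nhds p)"
  shows "smooth_near A p h"
proof -
  obtain W where W: "open W" "p \<in> W" "smooth_fun A W f"
    using assms(1) unfolding smooth_near_def by blast
  obtain V where V: "open V" "p \<in> V" "\<And>x. x \<in> V \<Longrightarrow> f x = h x"
    using assms(2) unfolding eventually_nhds by blast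
  show ?thesis
    by (rule smooth_nearI[of "W \<inter> V"])
      (use W V in \<open>auto intro!: smooth_fun_cong[of _ f h] intro: smooth_fun_mono\<close>)
qed

section \<open>Tangent vectors and vector fields\<close>

text \<open>The locality clause of \<open>tangent_space\<close> asks for smoothness of both
  functions; that of \<open>h\<close> follows from that of \<open>f\<close>, since they agree near
  \<open>p\<close>.\<close>

lemma tangent_space_cong:
  "v \<in> tangent_space A p \<Longrightarrow> smooth_near A p f \<Longrightarrow> eventually (\<lambda>x. f x = h x) (nhds p)
    \<Longrightarrow> tapp v f = tapp v h"
  using smooth_near_cong unfolding tangent_space_def by blast

text \<open>Homogeneity with the factor 0, applied to the zero function, which is smooth.\<close>

lemma tangent_space_zero: "v \<in> tangent_space A p \<Longrightarrow> tapp v (\<lambda>x. 0) = 0"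
proof -
  assume "v \<in> tangent_space A p"
  then have "tapp v (\<lambda>x. 0 * (0::real)) = 0 * tapp v (\<lambda>x. 0)"
    unfolding tangent_space_def using smooth_near_const[of p 0] by blast
  then show ?thesis by simp
qed

text \<open>Every clause of \<open>tangent_space\<close> is a homogeneous linear condition on the
  functional, including the default value 0 on functions that are not smooth near
  \<open>p\<close>.\<close>

lemma subspace_tangent_space: "subspace (tangent_space A p)"
  unfolding subspace_def
proof (intro conjI ballI allI)
  show "0 \<in> tangent_space A p"
    by (simp add: tangent_space_def)
  show "x + y \<in> tangent_space A p" if "x \<in> tangent_space A p" "y \<in> tangent_space A p" for x y
    unfolding tangent_space_def mem_Collect_eq
  proof (intro conjI allI impI)
    fix f h :: "'m \<Rightarrow> real" assume "smooth_near A p f \<and> smooth_near A p h"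
    with that show "tapp (x + y) (\<lambda>x. f x + h x) = tapp (x + y) f + tapp (x + y) h"
      "tapp (x + y) (\<lambda>x. f x * h x) = tapp (x + y) f * h p + f p * tapp (x + y) h"
      unfolding tangent_space_def mem_Collect_eq tapp_simps
      by (simp_all only: algebra_simps)
  next
    fix f c assume "smooth_near A p f"
    with that have "tapp x (\<lambda>x. c * f x) = c * tapp x f" "tapp y (\<lambda>x. c * f x) = c * tapp y f"
      unfolding tangent_space_def by blast+
    then show "tapp (x + y) (\<lambda>x. c * f x) = c * tapp (x + y) f"
      by (simp add: distrib_left)
  next
    fix f h assume "smooth_near A p f \<and> smooth_near A p h \<and> (\<forall>\<^sub>F x in nhds p. f x = h x)"
    then show "tapp (x + y) f = tapp (x + y) h"
      using tangent_space_cong[OF that(1), of f h] tangent_space_cong[OF that(2), of f h] by simp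
  next
    fix f assume "\<not> smooth_near A p f"
    with that show "tapp (x + y) f = 0"
      unfolding tangent_space_def by simp
  qed
  show "c *\<^sub>R x \<in> tangent_space A p" if "x \<in> tangent_space A p" for c x
    unfolding tangent_space_def mem_Collect_eq
  proof (intro conjI allI impI)
    fix f h :: "'m \<Rightarrow> real" assume "smooth_near A p f \<and> smooth_near A p h"
    with that show "tapp (c *\<^sub>R x) (\<lambda>x. f x + h x) = tapp (c *\<^sub>R x) f + tapp (c *\<^sub>R x) h"
      "tapp (c *\<^sub>R x) (\<lambda>x. f x * h x) = tapp (c *\<^sub>R x) f * h p + f p * tapp (c *\<^sub>R x) h"
      unfolding tangent_space_def mem_Collect_eq tapp_simps
      by (simp_all only: algebra_simps)
  next
    fix f d assume "smooth_near A p f"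
    with that have "tapp x (\<lambda>x. d * f x) = d * tapp x f"
      unfolding tangent_space_def by blast
    then show "tapp (c *\<^sub>R x) (\<lambda>x. d * f x) = d * tapp (c *\<^sub>R x) f"
      by simp
  next
    fix f h assume "smooth_near A p f \<and> smooth_near A p h \<and> (\<forall>\<^sub>F x in nhds p. f x = h x)"
    then show "tapp (c *\<^sub>R x) f = tapp (c *\<^sub>R x) h"
      using tangent_space_cong[OF that, of f h] by simp
  next
    fix f assume "\<not> smooth_near A p f"
    with that show "tapp (c *\<^sub>R x) f = 0"
      unfolding tangent_space_def by simp
  qed
qed

section \<open>Algebra of local vector fields\<close>

lemma vector_field_mono: "vector_field A U X \<Longrightarrow> V \<subseteq> U \<Longrightarrow> vector_field A V X"
  unfolding vector_field_def by (meson order_trans subsetD)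

lemma vector_field_cong:
  assumes "vector_field A U X" "\<And>p. p \<in> U \<Longrightarrow> X p = Y p"
  shows "vector_field A U Y"
  unfolding vector_field_def
proof (intro conjI ballI allI impI)
  show "Y p \<in> tangent_space A p" if "p \<in> U" for p
    using assms that unfolding vector_field_def by metis
  fix V f assume V: "open V \<and> V \<subseteq> U \<and> smooth_fun A V f"
  then have "smooth_fun A V (\<lambda>p. tapp (X p) f)"
    using assms(1) unfolding vector_field_def by blast
  then show "smooth_fun A V (\<lambda>p. tapp (Y p) f)"
    by (rule smooth_fun_cong[rotated -1]) (use V assms(2) in auto)
qed

lemma vector_field_add:
  "vector_field A U X \<Longrightarrow> vector_field A U Y \<Longrightarrow> vector_field A U (\<lambda>p. X p + Y p)"
  unfolding vector_field_def
  by (auto intro!: smooth_fun_add subspace_add[OF subspace_tangent_space])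

lemma vector_field_scale:
  "vector_field A U X \<Longrightarrow> smooth_fun A U f \<Longrightarrow> vector_field A U (\<lambda>p. f p *\<^sub>R X p)"
  unfolding vector_field_def
  by (auto intro!: smooth_fun_mult subspace_scale[OF subspace_tangent_space] intro: smooth_fun_mono)

lemma vector_field_zero: "vector_field A U (\<lambda>p. 0)"
  unfolding vector_field_def by (auto simp: subspace_0[OF subspace_tangent_space])

lemma vector_field_diff:
  "vector_field A U X \<Longrightarrow> vector_field A U Y \<Longrightarrow> vector_field A U (\<lambda>p. X p - Y p)"
  using vector_field_add[OF _ vector_field_scale[of U Y "\<lambda>_. - 1"]] by simp

lemma vector_field_nearI: "open U \<Longrightarrow> p \<in> U \<Longrightarrow> vector_field A U X \<Longrightarrow> vector_field_near A p X"
  unfolding vector_field_near_def by blast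

lemma vector_field_tangent: "vector_field A U X \<Longrightarrow> p \<in> U \<Longrightarrow> X p \<in> tangent_space A p"
  unfolding vector_field_def by blast

lemma smooth_near_tapp:
  assumes "vector_field A U X" "open U" "p \<in> U" "smooth_near A p f"
  shows "smooth_near A p (\<lambda>q. tapp (X q) f)"
proof -
  obtain W where W: "open W" "p \<in> W" "smooth_fun A W f"
    using assms(4) unfolding smooth_near_def by blast
  then have "smooth_fun A (W \<inter> U) f" "open (W \<inter> U)"
    using assms by (auto intro: smooth_fun_mono)
  then have "smooth_fun A (W \<inter> U) (\<lambda>q. tapp (X q) f)"
    using assms(1) unfolding vector_field_def by blast
  then show ?thesis using W assms by (auto intro!: smooth_nearI[of "W \<inter> U"])
qed

end

section \<open>Orthogonal projections\<close>

locale riemannian =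
  fixes A :: "('m::{t2_space,second_countable_topology}, 'e::real_inner) atlas"
    and g :: "'m metric_tensor"
  assumes riemannian: "riemannian_manifold A g"
begin

section \<open>The metric as an inner product on each tangent space\<close>

lemma atlas: "smooth_atlas A"
  using riemannian unfolding riemannian_manifold_def by blast

lemmas subspace_T = subspace_tangent_space[OF atlas]
lemmas T_intros = subspace_0[OF subspace_T] subspace_add[OF subspace_T] subspace_diff[OF subspace_T]
  subspace_neg[OF subspace_T] subspace_scale[OF subspace_T]

lemma metric_sym: "u \<in> tangent_space A p \<Longrightarrow> v \<in> tangent_space A p \<Longrightarrow> g p u v = g p v u"
  using riemannian unfolding riemannian_manifold_def by blast

lemma metric_pos: "u \<in> tangent_space A p \<Longrightarrow> u \<noteq> 0 \<Longrightarrow> g p u u > 0"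
  using riemannian unfolding riemannian_manifold_def by blast

lemma metric_lin:
  "u \<in> tangent_space A p \<Longrightarrow> v \<in> tangent_space A p \<Longrightarrow> w \<in> tangent_space A p \<Longrightarrow>
    g p (a *\<^sub>R u + b *\<^sub>R v) w = a * g p u w + b * g p v w"
  using riemannian unfolding riemannian_manifold_def by blast

lemma metric_left:
  "u \<in> tangent_space A p \<Longrightarrow> v \<in> tangent_space A p \<Longrightarrow> w \<in> tangent_space A p \<Longrightarrow> g p (u + v) w = g p u w + g p v w"
  "u \<in> tangent_space A p \<Longrightarrow> v \<in> tangent_space A p \<Longrightarrow> w \<in> tangent_space A p \<Longrightarrow> g p (u - v) w = g p u w - g p v w"
  "u \<in> tangent_space A p \<Longrightarrow> w \<in> tangent_space A p \<Longrightarrow> g p (- u) w = - g p u w"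
  "u \<in> tangent_space A p \<Longrightarrow> w \<in> tangent_space A p \<Longrightarrow> g p (a *\<^sub>R u) w = a * g p u w"
  "w \<in> tangent_space A p \<Longrightarrow> g p 0 w = 0"
  using metric_lin[of u p v w 1 1] metric_lin[of u p v w 1 "-1"] metric_lin[of u p u w "-1" 0]
    metric_lin[of u p u w a 0] metric_lin[of w p w w 0 0]
  by simp_all

lemma metric_right:
  "u \<in> tangent_space A p \<Longrightarrow> v \<in> tangent_space A p \<Longrightarrow> w \<in> tangent_space A p \<Longrightarrow> g p w (u + v) = g p w u + g p w v"
  "u \<in> tangent_space A p \<Longrightarrow> v \<in> tangent_space A p \<Longrightarrow> w \<in> tangent_space A p \<Longrightarrow> g p w (u - v) = g p w u - g p w v"
  "u \<in> tangent_space A p \<Longrightarrow> w \<in> tangent_space A p \<Longrightarrow> g p w (- u) = - g p w u"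
  "u \<in> tangent_space A p \<Longrightarrow> w \<in> tangent_space A p \<Longrightarrow> g p w (a *\<^sub>R u) = a * g p w u"
  "w \<in> tangent_space A p \<Longrightarrow> g p w 0 = 0"
  by (simp_all add: metric_sym[of w] metric_left T_intros)

lemma metric_smooth:
  "open U \<Longrightarrow> vector_field A U X \<Longrightarrow> vector_field A U Y \<Longrightarrow> smooth_fun A U (\<lambda>p. g p (X p) (Y p))"
  using riemannian unfolding riemannian_manifold_def by blast

lemma metric_eq_0: "u \<in> tangent_space A p \<Longrightarrow> g p u u = 0 \<Longrightarrow> u = 0"
  using metric_pos by fastforce

lemma metric_nonneg: "u \<in> tangent_space A p \<Longrightarrow> g p u u \<ge> 0"
  using metric_pos[of u p] metric_left(5)[of u p] by (cases "u = 0") auto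

lemma Cauchy_Schwarz:
  assumes "u \<in> tangent_space A p" "v \<in> tangent_space A p"
  shows "\<bar>g p u v\<bar> \<le> sqrt (g p u u) * sqrt (g p v v)"
proof (cases "v = 0")
  case True
  then show ?thesis using assms by (simp add: metric_right)
next
  case False
  have pos: "g p v v > 0" using metric_pos[OF assms(2) False] .
  \<comment> \<open>This is the component of \<open>u\<close> orthogonal to \<open>v\<close>,
    multiplied by \<open>g p v v\<close> to avoid a division.\<close>
  define w where "w = g p v v *\<^sub>R u - g p u v *\<^sub>R v"
  have "0 \<le> g p w w"
    unfolding w_def using assms by (intro metric_nonneg T_intros)
  also have "g p w w = g p v v * (g p u u * g p v v - (g p u v)\<^sup>2)"
    unfolding w_def using assms metric_sym[OF assms]
    by (simp add: metric_left metric_right T_intros power2_eq_square algebra_simps)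
  finally have "(g p u v)\<^sup>2 \<le> g p u u * g p v v"
    using pos by (simp add: zero_le_mult_iff)
  then have "sqrt ((g p u v)\<^sup>2) \<le> sqrt (g p u u * g p v v)"
    by (rule real_sqrt_le_mono)
  then show ?thesis by (simp add: real_sqrt_mult)
qed

text \<open>Here \<open>pr\<close> is any map with the defining property of the orthogonal
  projection, plus smoothness. In this form it can be built up one frame vector at a time;
  uniqueness identifies it with the description in \<open>orth_proj\<close> later.\<close>

definition smooth_orth_proj :: "'m set \<Rightarrow> ('m \<Rightarrow> 'm tvec set) \<Rightarrow> ('m \<Rightarrow> 'm tvec \<Rightarrow> 'm tvec) \<Rightarrow> bool" where
  "smooth_orth_proj U D pr \<longleftrightarrow>
     (\<forall>q\<in>U. subspace (D q) \<and> D q \<subseteq> tangent_space A q \<and>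
        (\<forall>e\<in>tangent_space A q. pr q e \<in> D q \<and> (\<forall>w\<in>D q. g q (e - pr q e) w = 0))) \<and>
     (\<forall>V Y. open V \<and> V \<subseteq> U \<and> vector_field A V Y \<longrightarrow> vector_field A V (\<lambda>q. pr q (Y q)))"

lemma smooth_orth_projD:
  assumes "smooth_orth_proj U D pr" "q \<in> U"
  shows "subspace (D q)" "w \<in> D q \<Longrightarrow> w \<in> tangent_space A q"
    "e \<in> tangent_space A q \<Longrightarrow> pr q e \<in> D q"
    "e \<in> tangent_space A q \<Longrightarrow> w \<in> D q \<Longrightarrow> g q (e - pr q e) w = 0"
  using assms unfolding smooth_orth_proj_def by auto

lemma smooth_orth_proj_vector_field:
  "smooth_orth_proj U D pr \<Longrightarrow> open V \<Longrightarrow> V \<subseteq> U \<Longrightarrow> vector_field A V Y \<Longrightarrow>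
    vector_field A V (\<lambda>q. pr q (Y q))"
  unfolding smooth_orth_proj_def by blast

text \<open>One Gram-Schmidt step: \<open>E\<close> is the part of \<open>X\<close> orthogonal to
  \<open>D\<close>, and the new projection adds the component of \<open>e\<close> along
  \<open>E\<close>. Its coefficient is a quotient of smooth functions, so smoothness
  persists.\<close>

lemma smooth_orth_proj_extend:
  assumes pr: "smooth_orth_proj U D pr" and U: "open U" and X: "vector_field A U X"
    and nin: "\<And>q. q \<in> U \<Longrightarrow> X q \<notin> D q"
  shows "\<exists>pr'. smooth_orth_proj U (\<lambda>q. span (insert (X q) (D q))) pr'"
proof -
  define E where "E q = X q - pr q (X q)" for q
  define pr' where "pr' q e = pr q e + (g q e (E q) * inverse (g q (E q) (E q))) *\<^sub>R E q" for q e
  have E: "vector_field A U E"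
    unfolding E_def using pr U X by (auto simp: smooth_orth_proj_def intro!: vector_field_diff[OF atlas])
  have ET: "E q \<in> tangent_space A q" if "q \<in> U" for q
    using vector_field_tangent[OF atlas E that] .
  \<comment> \<open>If \<open>E q\<close> vanished, \<open>X q\<close> would lie in
    \<open>D q\<close>, against \<open>nin\<close>; this justifies the division in
    \<open>pr'\<close>.\<close>
  have E0: "g q (E q) (E q) \<noteq> 0" if q: "q \<in> U" for q
  proof
    assume "g q (E q) (E q) = 0"
    then have "X q = pr q (X q)"
      using metric_eq_0[OF ET[OF q]] by (simp add: E_def)
    moreover have "pr q (X q) \<in> D q"
      using smooth_orth_projD(3)[OF pr q vector_field_tangent[OF atlas X q]] .
    ultimately show False using nin[OF q] by simp
  qed
  have "subspace (span (insert (X q) (D q))) \<and> span (insert (X q) (D q)) \<subseteq> tangent_space A q \<and>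
      (\<forall>e\<in>tangent_space A q. pr' q e \<in> span (insert (X q) (D q)) \<and>
        (\<forall>w\<in>span (insert (X q) (D q)). g q (e - pr' q e) w = 0))" if q: "q \<in> U" for q
  proof (intro conjI ballI)
    have XT: "X q \<in> tangent_space A q"
      using vector_field_tangent[OF atlas X q] .
    note Dq = smooth_orth_projD[OF pr q]
    show "subspace (span (insert (X q) (D q)))" by simp
    show S: "span (insert (X q) (D q)) \<subseteq> tangent_space A q"
      using XT Dq(2) by (intro span_minimal subspace_T) auto
    fix e assume e: "e \<in> tangent_space A q"
    have Es: "E q \<in> span (insert (X q) (D q))"
      unfolding E_def using Dq(3)[OF XT] by (intro span_diff) (auto intro: span_base)
    then show "pr' q e \<in> span (insert (X q) (D q))"
      unfolding pr'_def using Dq(3)[OF e] by (intro span_add span_scale) (auto intro: span_base)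
    have prT: "pr q e \<in> tangent_space A q" "pr q (X q) \<in> tangent_space A q"
      using Dq(2,3) e XT by auto
    have 1: "g q (e - pr' q e) w = 0" if w: "w \<in> D q" for w
    proof -
      have "g q (E q) w = 0"
        unfolding E_def using Dq(4)[OF XT w] .
      moreover have "w \<in> tangent_space A q" using w Dq(2) by blast
      ultimately show ?thesis
        using Dq(4)[OF e w] e prT ET[OF q] unfolding pr'_def
        by (simp add: metric_left T_intros)
    qed
    have 2: "g q (e - pr' q e) (E q) = 0"
    proof -
      have "g q (pr q e) (E q) = 0"
        using Dq(4)[OF XT Dq(3)[OF e]] metric_sym[OF prT(1) ET[OF q]] by (simp add: E_def)
      then show ?thesis
        using e prT ET[OF q] E0[OF q] unfolding pr'_def
        by (simp add: metric_left T_intros)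
    qed
    have e': "e - pr' q e \<in> tangent_space A q"
      unfolding pr'_def using e prT ET[OF q] by (intro T_intros)
    have 3: "g q (e - pr' q e) (X q) = 0"
    proof -
      have "X q = E q + pr q (X q)" by (simp add: E_def)
      then have "g q (e - pr' q e) (X q) = g q (e - pr' q e) (E q) + g q (e - pr' q e) (pr q (X q))"
        using metric_right(1)[OF ET[OF q] prT(2) e'] by simp
      then show ?thesis using 1[OF Dq(3)[OF XT]] 2 by simp
    qed
    \<comment> \<open>The vectors orthogonal to the residual \<open>e - pr' q e\<close> form a
      subspace, so testing \<open>X q\<close> and \<open>D q\<close> suffices.\<close>
    have "span (insert (X q) (D q)) \<subseteq> {w \<in> tangent_space A q. g q (e - pr' q e) w = 0}"
    proof (rule span_minimal)
      show "insert (X q) (D q) \<subseteq> {w \<in> tangent_space A q. g q (e - pr' q e) w = 0}"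
        using 1 3 XT Dq(2) by auto
      show "subspace {w \<in> tangent_space A q. g q (e - pr' q e) w = 0}"
        unfolding subspace_def using metric_right e' by (auto intro!: T_intros)
    qed
    then show "g q (e - pr' q e) w = 0" if "w \<in> span (insert (X q) (D q))" for w
      using that by blast
  qed
  moreover have "vector_field A V (\<lambda>q. pr' q (Y q))"
    if V: "open V" "V \<subseteq> U" "vector_field A V Y" for V Y
  proof -
    have EV: "vector_field A V E" using vector_field_mono[OF atlas E V(2)] .
    have "vector_field A V (\<lambda>q. pr q (Y q))"
      using smooth_orth_proj_vector_field[OF pr V] .
    moreover have "smooth_fun A V (\<lambda>q. g q (Y q) (E q) * inverse (g q (E q) (E q)))"
      using V EV E0 by (intro smooth_fun_mult[OF atlas] smooth_fun_inverse[OF atlas] metric_smooth) auto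
    ultimately show ?thesis
      unfolding pr'_def using EV
      by (intro vector_field_add[OF atlas] vector_field_scale[OF atlas])
  qed
  ultimately show ?thesis unfolding smooth_orth_proj_def by blast
qed

text \<open>Gram-Schmidt along the frame: the empty frame spans the zero distribution with
  projection 0, and independence keeps each new vector outside the span of its predecessors.\<close>

lemma smooth_orth_proj_frame:
  fixes X :: "nat \<Rightarrow> 'm \<Rightarrow> 'm tvec"
  assumes U: "open U" and X: "\<And>i. i < k \<Longrightarrow> vector_field A U (X i)"
    and indep: "\<And>q. q \<in> U \<Longrightarrow> inj_on (\<lambda>i. X i q) {..<k} \<and> independent ((\<lambda>i. X i q) ` {..<k})"
  shows "\<exists>pr. smooth_orth_proj U (\<lambda>q. span ((\<lambda>i. X i q) ` {..<k})) pr"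
  using X indep
proof (induction k)
  case 0
  have "smooth_orth_proj U (\<lambda>q. span ((\<lambda>i. X i q) ` {..<0})) (\<lambda>q e. 0)"
    unfolding smooth_orth_proj_def
    by (auto simp: T_intros metric_right vector_field_zero[OF atlas])
  then show ?case by blast
next
  case (Suc k)
  have indep': "inj_on (\<lambda>i. X i q) {..<k} \<and> X k q \<notin> span ((\<lambda>i. X i q) ` {..<k}) \<and>
      independent ((\<lambda>i. X i q) ` {..<k})" if "q \<in> U" for q
  proof -
    \<comment> \<open>Injectivity of the indexing shows that the new frame vector repeats no earlier
      one; with that, independence of the inserted set places it outside their span.\<close>
    have "inj_on (\<lambda>i. X i q) (insert k {..<k})" "independent (insert (X k q) ((\<lambda>i. X i q) ` {..<k}))"
      using Suc.prems(2)[OF that] by (simp_all add: lessThan_Suc)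
    moreover from this(1) have "X k q \<notin> (\<lambda>i. X i q) ` {..<k}"
      by (auto simp: inj_on_def)
    ultimately show ?thesis
      by (auto simp: independent_insert inj_on_insert)
  qed
  obtain pr where "smooth_orth_proj U (\<lambda>q. span ((\<lambda>i. X i q) ` {..<k})) pr"
    using Suc.IH Suc.prems(1) indep' by auto
  then have "\<exists>pr'. smooth_orth_proj U (\<lambda>q. span (insert (X k q) (span ((\<lambda>i. X i q) ` {..<k})))) pr'"
    by (rule smooth_orth_proj_extend[OF _ U]) (use Suc.prems(1) indep' in auto)
  moreover have "span (insert (X k q) (span ((\<lambda>i. X i q) ` {..<k}))) = span ((\<lambda>i. X i q) ` {..<Suc k})" for q
    by (simp add: lessThan_Suc span_insert span_span)
  ultimately show ?case by simp
qed

lemma smooth_orth_proj_distribution: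
  assumes "distribution A D"
  shows "\<exists>U pr. open U \<and> p \<in> U \<and> smooth_orth_proj U D pr"
proof -
  obtain k U X where U: "open U" "p \<in> U" "\<And>i. i < k \<Longrightarrow> vector_field A U (X i)"
    and X: "\<And>q. q \<in> U \<Longrightarrow> inj_on (\<lambda>i. X i q) {..<k} \<and> independent ((\<lambda>i. X i q) ` {..<(k::nat)}) \<and>
        D q = span ((\<lambda>i. X i q) ` {..<k})"
    using assms unfolding distribution_def by metis
  obtain pr where "smooth_orth_proj U (\<lambda>q. span ((\<lambda>i. X i q) ` {..<k})) pr"
    using smooth_orth_proj_frame[OF U(1), of k X] U(3) X by auto
  then have "smooth_orth_proj U D pr"
    using X unfolding smooth_orth_proj_def by auto
  with U show ?thesis by blast
qed

lemma smooth_orth_proj_mono: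
  assumes "smooth_orth_proj U D pr" "V \<subseteq> U"
  shows "smooth_orth_proj V D pr"
proof -
  have "W \<subseteq> U" if "W \<subseteq> V" for W using that assms(2) by simp
  then show ?thesis
    using assms(1) subsetD[OF assms(2)] unfolding smooth_orth_proj_def by simp
qed

text \<open>Against \<open>w = x + y\<close> the cross terms of \<open>pr1\<close> with
  \<open>y\<close> and of \<open>pr2\<close> with \<open>x\<close> vanish by orthogonality, so the
  projections add. The vertical distribution gets its smooth projection from the two slant summands
  this way.\<close>

lemma smooth_orth_proj_sum:
  assumes 1: "smooth_orth_proj U D1 pr1" and 2: "smooth_orth_proj U D2 pr2"
    and K: "\<And>q. K q = {x + y |x y. x \<in> D1 q \<and> y \<in> D2 q}"
    and orth: "\<And>q x y. x \<in> D1 q \<Longrightarrow> y \<in> D2 q \<Longrightarrow> g q x y = 0"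
  shows "smooth_orth_proj U K (\<lambda>q e. pr1 q e + pr2 q e)"
  unfolding smooth_orth_proj_def
proof (intro conjI ballI allI impI)
  fix q assume q: "q \<in> U"
  note D1 = smooth_orth_projD[OF 1 q] and D2 = smooth_orth_projD[OF 2 q]
  show "subspace (K q)"
    unfolding K using subspace_sums[OF D1(1) D2(1)] .
  show "K q \<subseteq> tangent_space A q"
    unfolding K using D1(2) D2(2) by (auto intro!: T_intros)
  fix e assume e: "e \<in> tangent_space A q"
  show "pr1 q e + pr2 q e \<in> K q"
    unfolding K using D1(3)[OF e] D2(3)[OF e] by blast
  fix w assume "w \<in> K q"
  then obtain x y where w: "w = x + y" "x \<in> D1 q" "y \<in> D2 q" unfolding K by blast
  have T: "x \<in> tangent_space A q" "y \<in> tangent_space A q" "pr1 q e \<in> tangent_space A q" "pr2 q e \<in> tangent_space A q"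
    using w D1(2) D2(2) D1(3)[OF e] D2(3)[OF e] by auto
  have "g q (pr2 q e) x = 0" "g q (pr1 q e) y = 0"
    using orth[OF w(2) D2(3)[OF e]] orth[OF D1(3)[OF e] w(3)] metric_sym[OF T(1,4)] by simp_all
  then show "g q (e - (pr1 q e + pr2 q e)) w = 0"
    using D1(4)[OF e w(2)] D2(4)[OF e w(3)] T e w(1) by (simp add: metric_left metric_right T_intros)
next
  fix V Y assume "open V \<and> V \<subseteq> U \<and> vector_field A V Y"
  then show "vector_field A V (\<lambda>q. pr1 q (Y q) + pr2 q (Y q))"
    using vector_field_add[OF atlas smooth_orth_proj_vector_field[OF 1] smooth_orth_proj_vector_field[OF 2]]
    by simp
qed

end

section \<open>Vertical and horizontal projections of a smooth distribution\<close>

locale smooth_distribution = riemannian A g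
  for A :: "('m::{t2_space,second_countable_topology}, 'e::real_inner) atlas" and g +
  fixes K :: "'m \<Rightarrow> 'm tvec set"
  assumes local_proj: "\<exists>U pr. open U \<and> p \<in> U \<and> smooth_orth_proj U K pr"
begin

abbreviation "ver \<equiv> ver_proj g K"
abbreviation "hor \<equiv> hor_proj A g K"
abbreviation "H \<equiv> orth_compl A g K"

lemma subspace_K: "subspace (K p)" and K_T: "v \<in> K p \<Longrightarrow> v \<in> tangent_space A p"
  using local_proj[of p] unfolding smooth_orth_proj_def by blast+

lemma H_T: "v \<in> H p \<Longrightarrow> v \<in> tangent_space A p"
  unfolding orth_compl_def by blast

lemma K_H: "v \<in> K p \<Longrightarrow> w \<in> H p \<Longrightarrow> g p v w = 0" "v \<in> K p \<Longrightarrow> w \<in> H p \<Longrightarrow> g p w v = 0"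
  using metric_sym[OF K_T H_T] unfolding orth_compl_def by auto

lemma subspace_H: "subspace (H p)"
  unfolding orth_compl_def subspace_def
  using K_T metric_left by (auto intro!: T_intros)

lemmas K_intros = subspace_0[OF subspace_K] subspace_add[OF subspace_K] subspace_diff[OF subspace_K]
  subspace_neg[OF subspace_K] subspace_scale[OF subspace_K]
lemmas H_intros = subspace_0[OF subspace_H] subspace_add[OF subspace_H] subspace_diff[OF subspace_H]
  subspace_neg[OF subspace_H] subspace_scale[OF subspace_H]

text \<open>The difference of two candidates lies in the subspace and is orthogonal to it, hence to
  itself, so positivity makes it zero. The subspace is left general to serve both \<open>K\<close>
  and \<open>H\<close>.\<close>

lemma orth_proj_eqI:
  assumes "subspace (S p)" "\<And>w. w \<in> S p \<Longrightarrow> w \<in> tangent_space A p" "e \<in> tangent_space A p"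
    and "v \<in> S p" "\<And>w. w \<in> S p \<Longrightarrow> g p (e - v) w = 0"
  shows "orth_proj g S p e = v"
  unfolding orth_proj_def
proof (rule the_equality)
  show "v \<in> S p \<and> (\<forall>w\<in>S p. g p (e - v) w = 0)" using assms by auto
  fix u assume u: "u \<in> S p \<and> (\<forall>w\<in>S p. g p (e - u) w = 0)"
  then have D: "u - v \<in> S p" using assms by (auto intro: subspace_diff)
  have T: "u \<in> tangent_space A p" "v \<in> tangent_space A p" using u assms by auto
  have "u - v = (e - v) - (e - u)" by simp
  then have "g p (u - v) (u - v) = g p (e - v) (u - v) - g p (e - u) (u - v)"
    using metric_left(2)[of "e - v" p "e - u" "u - v"] T assms(3) by (simp add: T_intros)
  also have "\<dots> = 0" using u D assms by simp
  finally show "u = v" using metric_eq_0[of "u - v" p] T by (simp add: T_intros)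
qed

lemma decomp_ex:
  assumes "e \<in> tangent_space A p"
  shows "\<exists>v. v \<in> K p \<and> e - v \<in> H p"
proof -
  obtain U pr where "p \<in> U" "smooth_orth_proj U K pr" using local_proj by blast
  note pr = smooth_orth_projD[OF this(2,1)]
  have "e - pr p e \<in> H p"
    unfolding orth_compl_def using pr(2,3,4) assms by (auto intro: T_intros)
  with pr(3)[OF assms] show ?thesis by blast
qed

text \<open>By uniqueness it is enough to exhibit a vertical and a horizontal summand; all algebraic
  rules for \<open>ver\<close> and \<open>hor\<close> below are read off from such
  decompositions.\<close>

lemma proj_eqI:
  assumes "v \<in> K p" "h \<in> H p"
  shows "ver p (v + h) = v" "hor p (v + h) = h"
proof -
  have T: "v + h \<in> tangent_space A p" using K_T[OF assms(1)] H_T[OF assms(2)] by (rule T_intros)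
  show "ver p (v + h) = v"
    unfolding ver_proj_def
    by (rule orth_proj_eqI[where S = K, OF subspace_K K_T T assms(1)]) (auto intro: K_T K_H assms)
  show "hor p (v + h) = h"
    unfolding hor_proj_def
    by (rule orth_proj_eqI[where S = H, OF subspace_H H_T T assms(2)]) (auto intro: H_T K_H assms)
qed

lemma
  assumes "e \<in> tangent_space A p"
  shows ver_K: "ver p e \<in> K p" and hor_H: "hor p e \<in> H p" and ver_hor: "ver p e + hor p e = e"
proof -
  obtain v where v: "v \<in> K p" "e - v \<in> H p" using decomp_ex[OF assms] by blast
  have "ver p e = v" "hor p e = e - v" using proj_eqI[OF v] by simp_all
  with v show "ver p e \<in> K p" "hor p e \<in> H p" "ver p e + hor p e = e" by simp_all
qed

lemma proj_K: "v \<in> K p \<Longrightarrow> ver p v = v" "v \<in> K p \<Longrightarrow> hor p v = 0"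
  using proj_eqI[of v p 0] by (simp_all add: H_intros)

lemma proj_H: "h \<in> H p \<Longrightarrow> ver p h = 0" "h \<in> H p \<Longrightarrow> hor p h = h"
  using proj_eqI[of 0 p h] by (simp_all add: K_intros)

lemma hor_eq: "e \<in> tangent_space A p \<Longrightarrow> hor p e = e - ver p e"
  using ver_hor[of e p] by (simp add: algebra_simps)

lemma proj_add:
  assumes "u \<in> tangent_space A p" "v \<in> tangent_space A p"
  shows "ver p (u + v) = ver p u + ver p v" "hor p (u + v) = hor p u + hor p v"
proof -
  have *: "u + v = (ver p u + ver p v) + (hor p u + hor p v)"
    using ver_hor[OF assms(1)] ver_hor[OF assms(2)] by (simp add: algebra_simps)
  show "ver p (u + v) = ver p u + ver p v" "hor p (u + v) = hor p u + hor p v"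
    by (subst *, intro proj_eqI K_intros H_intros ver_K hor_H assms)+
qed

lemma proj_scale:
  assumes "u \<in> tangent_space A p"
  shows "ver p (c *\<^sub>R u) = c *\<^sub>R ver p u" "hor p (c *\<^sub>R u) = c *\<^sub>R hor p u"
proof -
  have *: "c *\<^sub>R u = c *\<^sub>R ver p u + c *\<^sub>R hor p u"
    using ver_hor[OF assms] by (simp flip: scaleR_add_right)
  show "ver p (c *\<^sub>R u) = c *\<^sub>R ver p u" "hor p (c *\<^sub>R u) = c *\<^sub>R hor p u"
    by (subst *, intro proj_eqI K_intros H_intros ver_K hor_H assms)+
qed

lemma proj_T: "e \<in> tangent_space A p \<Longrightarrow> ver p e \<in> tangent_space A p"
  "e \<in> tangent_space A p \<Longrightarrow> hor p e \<in> tangent_space A p"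
  using ver_K hor_H K_T H_T by blast+

text \<open>Uniqueness identifies \<open>ver\<close> with the local smooth projection
  \<open>pr\<close> on tangent vectors, and \<open>hor\<close> is the identity minus
  \<open>ver\<close>.\<close>

lemma smooth_proj:
  "\<exists>U. open U \<and> p \<in> U \<and> (\<forall>V Y. open V \<and> V \<subseteq> U \<and> vector_field A V Y \<longrightarrow>
     vector_field A V (\<lambda>q. ver q (Y q)) \<and> vector_field A V (\<lambda>q. hor q (Y q)))"
proof -
  obtain U pr where U: "open U" "p \<in> U" "smooth_orth_proj U K pr" using local_proj by blast
  have eq: "pr q e = ver q e" if "q \<in> U" "e \<in> tangent_space A q" for q e
    unfolding ver_proj_def using smooth_orth_projD[OF U(3) that(1)] that(2)
    by (intro orth_proj_eqI[symmetric, where S = K]) auto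
  have "vector_field A V (\<lambda>q. ver q (Y q)) \<and> vector_field A V (\<lambda>q. hor q (Y q))"
    if V: "open V" "V \<subseteq> U" "vector_field A V Y" for V Y
  proof
    have "vector_field A V (\<lambda>q. pr q (Y q))"
      using smooth_orth_proj_vector_field[OF U(3) V] .
    then show ver: "vector_field A V (\<lambda>q. ver q (Y q))"
      by (rule vector_field_cong[OF atlas])
        (use V eq vector_field_tangent[OF atlas V(3)] in auto)
    show "vector_field A V (\<lambda>q. hor q (Y q))"
      by (rule vector_field_cong[OF atlas vector_field_diff[OF atlas V(3) ver]])
        (simp add: hor_eq vector_field_tangent[OF atlas V(3)])
  qed
  with U show ?thesis by blast
qed

end

section \<open>Kaehler manifolds with a distribution\<close>

locale kaehler_distribution = smooth_distribution A g K
  for A :: "('m::{t2_space,second_countable_topology}, 'e::real_inner) atlas" and g K +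
  fixes nabla :: "'m connection" and J :: "'m \<Rightarrow> 'm tvec \<Rightarrow> 'm tvec"
  assumes levi_civita: "levi_civita A g nabla"
    and kaehler: "kaehler A g nabla J"
begin

section \<open>Pointwise rules for \<open>J\<close> and the connection\<close>

lemmas J_at = kaehler[unfolded kaehler_def, THEN conjunct1, rule_format]
lemmas levi_civita_at = levi_civita[unfolded levi_civita_def, THEN conjunct2, rule_format, OF conjI]

lemma affine: "affine_connection A nabla"
  using levi_civita unfolding levi_civita_def by blast

lemmas nabla_at = affine[unfolded affine_connection_def, THEN conjunct1, rule_format]

lemma J_T: "u \<in> tangent_space A p \<Longrightarrow> J p u \<in> tangent_space A p"
  and J_J: "u \<in> tangent_space A p \<Longrightarrow> J p (J p u) = - u"
  and J_metric: "u \<in> tangent_space A p \<Longrightarrow> v \<in> tangent_space A p \<Longrightarrow> g p (J p u) (J p v) = g p u v"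
  using J_at by simp_all

lemma J_lin: "u \<in> tangent_space A p \<Longrightarrow> v \<in> tangent_space A p \<Longrightarrow>
    J p (a *\<^sub>R u + b *\<^sub>R v) = a *\<^sub>R J p u + b *\<^sub>R J p v"
  using J_at by simp

lemma J_add: "u \<in> tangent_space A p \<Longrightarrow> v \<in> tangent_space A p \<Longrightarrow> J p (u + v) = J p u + J p v"
  using J_lin[of u p v 1 1] by simp

lemma J_scale: "u \<in> tangent_space A p \<Longrightarrow> J p (c *\<^sub>R u) = c *\<^sub>R J p u"
  using J_lin[of u p u c 0] by simp

text \<open>The isometry property for the pair \<open>J p u\<close>, \<open>v\<close>, where
  \<open>J\<close> squares to minus the identity.\<close>

lemma J_skew:
  assumes "u \<in> tangent_space A p" "v \<in> tangent_space A p"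
  shows "g p (J p u) v = - g p u (J p v)"
  using J_metric[OF J_T[OF assms(1)] assms(2)] J_T[OF assms(2)] assms
  by (simp add: J_J metric_left)

lemma J_vector_field: "open U \<Longrightarrow> vector_field A U X \<Longrightarrow> vector_field A U (\<lambda>p. J p (X p))"
  using kaehler[unfolded kaehler_def, THEN conjunct2, THEN conjunct1] by simp

lemma vector_field_near_J: "vector_field_near A p X \<Longrightarrow> vector_field_near A p (\<lambda>p. J p (X p))"
  unfolding vector_field_near_def using J_vector_field by blast

lemma vector_field_near_proj:
  assumes "vector_field_near A p X"
  shows "vector_field_near A p (\<lambda>q. ver q (X q))" "vector_field_near A p (\<lambda>q. hor q (X q))"
proof -
  obtain U where U: "open U" "p \<in> U" "vector_field A U X"
    using assms unfolding vector_field_near_def by blast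
  obtain V where V: "open V" "p \<in> V" "\<And>W Y. open W \<Longrightarrow> W \<subseteq> V \<Longrightarrow> vector_field A W Y \<Longrightarrow>
     vector_field A W (\<lambda>q. ver q (Y q)) \<and> vector_field A W (\<lambda>q. hor q (Y q))"
    using smooth_proj[of p] by blast
  have UV: "open (U \<inter> V)" "U \<inter> V \<subseteq> V" "vector_field A (U \<inter> V) X" "p \<in> U \<inter> V"
    using U V vector_field_mono[OF atlas U(3)] by auto
  show "vector_field_near A p (\<lambda>q. ver q (X q))" "vector_field_near A p (\<lambda>q. hor q (X q))"
    using V(3)[OF UV(1,2,3)] UV(1,4) vector_field_nearI[OF atlas] by blast+
qed

lemma vector_field_near_T: "vector_field_near A p X \<Longrightarrow> X p \<in> tangent_space A p"
  unfolding vector_field_near_def using vector_field_tangent[OF atlas] by blast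

lemma vector_field_near_eventually_T:
  "vector_field_near A p X \<Longrightarrow> eventually (\<lambda>q. X q \<in> tangent_space A q) (nhds p)"
  unfolding vector_field_near_def eventually_nhds using vector_field_tangent[OF atlas] by blast

lemma vector_field_near_cong:
  assumes "vector_field_near A p X" "eventually (\<lambda>q. X q = Y q) (nhds p)"
  shows "vector_field_near A p Y"
proof -
  obtain U where U: "open U" "p \<in> U" "vector_field A U X"
    using assms unfolding vector_field_near_def by blast
  obtain V where V: "open V" "p \<in> V" "\<And>q. q \<in> V \<Longrightarrow> X q = Y q"
    using assms(2) unfolding eventually_nhds by blast
  have "vector_field A (U \<inter> V) Y"
    by (rule vector_field_cong[OF atlas vector_field_mono[OF atlas U(3)]]) (use V in auto)
  then show ?thesis
    using U V by (auto intro!: vector_field_nearI[OF atlas, of "U \<inter> V"])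
qed

lemma nabla_T: "vector_field_near A p Y \<Longrightarrow> v \<in> tangent_space A p \<Longrightarrow> nabla p v Y \<in> tangent_space A p"
  by (rule nabla_at[THEN conjunct1])

lemma nabla_add: "vector_field_near A p Y \<Longrightarrow> vector_field_near A p Z \<Longrightarrow> v \<in> tangent_space A p \<Longrightarrow>
    nabla p v (\<lambda>q. Y q + Z q) = nabla p v Y + nabla p v Z"
  by (rule nabla_at[THEN conjunct2, THEN conjunct2, THEN conjunct2, THEN spec, THEN mp, THEN conjunct1])

lemma nabla_cong:
  assumes "vector_field_near A p Y" "v \<in> tangent_space A p" "eventually (\<lambda>q. Y q = Z q) (nhds p)"
  shows "nabla p v Y = nabla p v Z"
  using nabla_at[THEN conjunct2, THEN conjunct2, THEN conjunct2, THEN spec, THEN mp, THEN conjunct2, THEN mp,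
      OF assms(1,2) vector_field_near_cong[OF assms(1,3)] assms(3)] .

text \<open>Additivity for 0 + 0 = 0 settles the zero field, and locality carries this over to
  fields that vanish near \<open>p\<close>.\<close>

lemma nabla_zero:
  assumes "v \<in> tangent_space A p" "eventually (\<lambda>q. Y q = 0) (nhds p)"
  shows "nabla p v Y = 0"
proof -
  have near: "vector_field_near A p (\<lambda>q. 0 :: 'm tvec)"
    using vector_field_nearI[OF atlas open_UNIV UNIV_I vector_field_zero[OF atlas]] .
  have "nabla p v (\<lambda>q. 0 + 0) = nabla p v (\<lambda>q. 0) + nabla p v (\<lambda>q. 0)"
    using nabla_add[OF near near assms(1)] .
  then have "nabla p v (\<lambda>q. 0) = 0" by simp
  moreover have "eventually (\<lambda>q. 0 = Y q) (nhds p)"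
    using assms(2) by (rule eventually_mono) simp
  ultimately show ?thesis
    using nabla_cong[OF near assms(1)] by metis
qed

lemma nabla_vector_field:
  "open U \<Longrightarrow> vector_field A U X \<Longrightarrow> vector_field A U Y \<Longrightarrow> vector_field A U (\<lambda>p. nabla p (X p) Y)"
  by (rule affine[unfolded affine_connection_def, THEN conjunct2, rule_format, OF conjI, OF _ conjI])

lemma nabla_J: "vector_field_near A p Y \<Longrightarrow> v \<in> tangent_space A p \<Longrightarrow>
    nabla p v (\<lambda>q. J q (Y q)) = J p (nabla p v Y)"
  by (rule kaehler[unfolded kaehler_def, THEN conjunct2, THEN conjunct2, rule_format])

lemma nabla_metric: "vector_field_near A p Y \<Longrightarrow> vector_field_near A p Z \<Longrightarrow> v \<in> tangent_space A p \<Longrightarrow>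
    tapp v (\<lambda>q. g q (Y q) (Z q)) = g p (nabla p v Y) (Z p) + g p (Y p) (nabla p v Z)"
  by (rule levi_civita_at[THEN conjunct2, rule_format])

lemma nabla_torsion: "vector_field_near A p Y \<Longrightarrow> vector_field_near A p Z \<Longrightarrow>
    nabla p (Y p) Z - nabla p (Z p) Y = lie_bracket A Y Z p"
  by (rule levi_civita_at[THEN conjunct1])

text \<open>The function \<open>g q (Y q) (Z q)\<close> vanishes near \<open>p\<close>, so its
  derivative is zero. The right-hand side involves \<open>Y\<close> only through its value at
  \<open>p\<close>, which is what later allows \<open>Y\<close> to be exchanged for other vertical
  fields.\<close>

lemma nabla_orthogonal:
  assumes "vector_field_near A p Y" "vector_field_near A p Z" "v \<in> tangent_space A p"
    and "eventually (\<lambda>q. g q (Y q) (Z q) = 0) (nhds p)"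
  shows "g p (nabla p v Y) (Z p) = - g p (Y p) (nabla p v Z)"
proof -
  have "eventually (\<lambda>q. 0 = g q (Y q) (Z q)) (nhds p)"
    using assms(4) by (rule eventually_mono) simp
  from tangent_space_cong[OF atlas assms(3) smooth_near_const[OF atlas] this]
  have "tapp v (\<lambda>q. 0) = tapp v (\<lambda>q. g q (Y q) (Z q))" .
  then show ?thesis
    using nabla_metric[OF assms(1-3)] tangent_space_zero[OF atlas assms(3)] by simp
qed

section \<open>The splitting of \<open>J\<close> and the O'Neill expression\<close>

abbreviation "P \<equiv> J_ver g K J"
abbreviation "F \<equiv> J_hor A g K J"

lemma J_split:
  assumes "u \<in> tangent_space A p"
  shows "P p u \<in> K p" "F p u \<in> H p" "P p u + F p u = J p u"
  unfolding J_ver_def J_hor_def using J_T[OF assms] by (simp_all add: ver_K hor_H ver_hor)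

lemma F_add: "u \<in> tangent_space A p \<Longrightarrow> v \<in> tangent_space A p \<Longrightarrow> F p (u + v) = F p u + F p v"
  and P_add: "u \<in> tangent_space A p \<Longrightarrow> v \<in> tangent_space A p \<Longrightarrow> P p (u + v) = P p u + P p v"
  unfolding J_hor_def J_ver_def by (simp_all add: J_add proj_add J_T)

lemma P_scale: "u \<in> tangent_space A p \<Longrightarrow> P p (c *\<^sub>R u) = c *\<^sub>R P p u"
  unfolding J_ver_def by (simp add: J_scale proj_scale J_T)

lemma section_onD:
  assumes "section_on A U K X" "open U" "p \<in> U"
  shows "vector_field_near A p X" "X p \<in> K p" "X p \<in> tangent_space A p"
    "eventually (\<lambda>q. X q \<in> K q) (nhds p)"
  using assms vector_field_nearI[OF atlas, of U p X] K_T
  unfolding section_on_def eventually_nhds by blast+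

text \<open>Since \<open>J\<close> is parallel, the expression is \<open>\<H> J (J \<nabla>\<^sub>W Z)\<close>.\<close>

lemma hor_nabla_formula:
  assumes U: "open U" "p \<in> U" and W: "section_on A U K W" and Z: "section_on A U K Z"
    and FZ: "hor p (nabla p (F p (Z p)) W) = hor p (nabla p (W p) (\<lambda>q. F q (Z q)))"
  shows "F p (oneill_T A g nabla K W (\<lambda>q. P q (Z q)) p + oneill_A A g nabla K (\<lambda>q. F q (Z q)) W p) +
      F p (nabla_hat g nabla K W (\<lambda>q. P q (Z q)) p + oneill_T A g nabla K W (\<lambda>q. F q (Z q)) p)
    = - hor p (nabla p (W p) Z)"
proof -
  note Wp = section_onD[OF W U] and Zp = section_onD[OF Z U]
  have near: "vector_field_near A p (\<lambda>q. P q (Z q))" "vector_field_near A p (\<lambda>q. F q (Z q))"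
    unfolding J_ver_def J_hor_def using vector_field_near_proj[OF vector_field_near_J[OF Zp(1)]] by auto
  define a where "a = nabla p (W p) (\<lambda>q. P q (Z q))"
  define b where "b = nabla p (W p) (\<lambda>q. F q (Z q))"
  define c where "c = nabla p (F p (Z p)) W"
  have FT: "F p (Z p) \<in> tangent_space A p" using J_split(2)[OF Zp(3)] H_T by blast
  have abT: "a \<in> tangent_space A p" "b \<in> tangent_space A p" "c \<in> tangent_space A p"
    unfolding a_def b_def c_def using nabla_T near Wp FT by auto
  have evZ: "eventually (\<lambda>q. Z q \<in> tangent_space A q) (nhds p)"
    using vector_field_near_eventually_T[OF Zp(1)] .
  \<comment> \<open>The fields \<open>PZ\<close> and \<open>W\<close> are vertical and
    \<open>FZ\<close> is horizontal near \<open>p\<close>, so their complementary projections vanish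
    there; this removes half of the terms in each O'Neill tensor.\<close>
  have zero: "nabla p (W p) (\<lambda>q. hor q (P q (Z q))) = 0" "nabla p (W p) (\<lambda>q. ver q (F q (Z q))) = 0"
      "nabla p (F p (Z p)) (\<lambda>q. hor q (W q)) = 0"
    by (rule nabla_zero, use Wp FT in blast,
        rule eventually_mono[OF evZ] eventually_mono[OF Wp(4)], simp add: J_split proj_K proj_H)+
  have same: "nabla p (W p) (\<lambda>q. ver q (P q (Z q))) = a" "nabla p (W p) (\<lambda>q. hor q (F q (Z q))) = b"
      "nabla p (F p (Z p)) (\<lambda>q. ver q (W q)) = c"
    unfolding a_def b_def c_def
    by (rule nabla_cong[symmetric], use near Wp in blast, use Wp FT in blast,
        rule eventually_mono[OF evZ] eventually_mono[OF Wp(4)], simp add: J_split proj_K proj_H)+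
  have 0: "ver p 0 = 0" "hor p 0 = 0"
    using proj_K(2)[of 0 p] proj_H(1)[of 0 p] by (simp_all add: K_intros H_intros)
  \<comment> \<open>Only \<open>A1\<close> uses the hypothesis \<open>FZ\<close>: the tensor yields
    \<open>hor p c\<close>, which is exchanged for \<open>hor p b\<close>.\<close>
  have T1: "oneill_T A g nabla K W (\<lambda>q. P q (Z q)) p = hor p a"
    and T2: "oneill_T A g nabla K W (\<lambda>q. F q (Z q)) p = ver p b"
    and A1: "oneill_A A g nabla K (\<lambda>q. F q (Z q)) W p = hor p b"
    and N1: "nabla_hat g nabla K W (\<lambda>q. P q (Z q)) p = ver p a"
    unfolding oneill_T_def oneill_A_def nabla_hat_def
    using FZ proj_H(2)[OF J_split(2)[OF Zp(3)]]
    by (simp_all add: proj_K(1)[OF Wp(2)] zero same 0 flip: a_def b_def c_def)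
  have N: "nabla p (W p) Z \<in> tangent_space A p"
    using nabla_T Zp Wp by blast
  have "a + b = nabla p (W p) (\<lambda>q. P q (Z q) + F q (Z q))"
    unfolding a_def b_def using nabla_add[OF near Wp(3)] by simp
  also have "\<dots> = nabla p (W p) (\<lambda>q. J q (Z q))"
    by (rule nabla_cong[symmetric, OF vector_field_near_J[OF Zp(1)] Wp(3)])
      (rule eventually_mono[OF evZ], simp add: J_split)
  also have "\<dots> = J p (nabla p (W p) Z)"
    using nabla_J[OF Zp(1) Wp(3)] .
  finally have ab: "a + b = J p (nabla p (W p) Z)" .
  \<comment> \<open>Since \<omega> and \<open>F\<close> are the same map \<open>J_hor\<close>,
    additivity merges the four projections back into \<open>a + b\<close>.\<close>
  have "F p (hor p a + hor p b) + F p (ver p a + ver p b) = F p ((hor p a + hor p b) + (ver p a + ver p b))"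
    using abT by (simp add: F_add proj_T T_intros)
  also have "(hor p a + hor p b) + (ver p a + ver p b) = a + b"
    using ver_hor[OF abT(1)] ver_hor[OF abT(2)] by (simp add: algebra_simps)
  also have "F p (a + b) = hor p (- nabla p (W p) Z)"
    unfolding ab J_hor_def using J_J[OF N] by simp
  also have "\<dots> = - hor p (nabla p (W p) Z)"
    using proj_scale(2)[OF N, of "-1"] by simp
  finally show ?thesis
    unfolding T1 T2 A1 N1 .
qed

section \<open>Linear algebra of a single slant distribution\<close>

context
  fixes D :: "'m \<Rightarrow> 'm tvec set" and \<theta> :: real
  assumes D: "subspace (D p)" "\<And>x. x \<in> D p \<Longrightarrow> x \<in> K p" "\<And>x. x \<in> D p \<Longrightarrow> P p x \<in> D p"
    and slant: "slant g J D \<theta>" and \<theta>: "0 < \<theta>" "\<theta> < pi / 2"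
begin

text \<open>For \<open>x \<in> D\<close> and \<open>w \<in> D\<close> one has \<open>g(Jx, w) = g(Px, w)\<close>, so by Cauchy-Schwarz the
  least angle between \<open>Jx\<close> and \<open>D\<close> is attained at \<open>w = Px\<close>.\<close>

lemma slant_norm:
  assumes "x \<in> D p"
  shows "g p (P p x) (P p x) = (cos \<theta>)\<^sup>2 * g p x x"
proof (cases "x = 0")
  case True
  moreover have "0 \<in> tangent_space A p" by (rule T_intros)
  ultimately show ?thesis
    using P_scale[of 0 p 0] by (simp add: metric_left)
next
  case False
  have T: "x \<in> tangent_space A p" "P p x \<in> tangent_space A p" "F p x \<in> tangent_space A p" "J p x \<in> tangent_space A p"
    using assms D K_T J_split(2) H_T J_T by auto
  have pos: "g p x x > 0" using metric_pos[OF T(1) False] .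
  define S where "S = {arccos (g p (J p x) w / (sqrt (g p (J p x) (J p x)) * sqrt (g p w w))) |w. w \<in> D p \<and> w \<noteq> 0}"
  have angle: "Inf S = \<theta>"
    using slant assms False unfolding slant_def angle_to_def S_def by blast
  have JP: "g p (J p x) w = g p (P p x) w" if "w \<in> D p" for w
  proof -
    have "g p (J p x) w = g p (P p x) w + g p (F p x) w"
      using metric_left(1)[OF T(2,3) K_T[OF D(2)[OF that]]] J_split(3)[OF T(1)] by simp
    then show ?thesis using K_H(2)[OF D(2)[OF that] J_split(2)[OF T(1)]] by simp
  qed
  have JJ: "g p (J p x) (J p x) = g p x x" using J_metric[OF T(1,1)] .
  have S: "S = (\<lambda>w. arccos (g p (P p x) w / (sqrt (g p x x) * sqrt (g p w w)))) ` {w \<in> D p. w \<noteq> 0}"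
    unfolding S_def JJ setcompr_eq_image by (intro image_cong) (auto simp: JP)
  \<comment> \<open>For \<open>P p x = 0\<close> every quotient in \<open>S\<close> would be 0, and
    the infimum would be pi/2, contradicting the upper bound on \<theta>.\<close>
  have Px: "P p x \<noteq> 0"
  proof
    assume "P p x = 0"
    then have "arccos (g p (P p x) w / (sqrt (g p x x) * sqrt (g p w w))) = pi / 2" if "w \<in> D p" for w
      using metric_left(5) K_T D(2)[OF that] by simp
    then have "S = (\<lambda>w. pi / 2) ` {w \<in> D p. w \<noteq> 0}"
      unfolding S by (intro image_cong) auto
    also have "\<dots> = {pi / 2}" using assms False by auto
    finally show False using angle \<theta> by simp
  qed
  have posP: "g p (P p x) (P p x) > 0" using metric_pos[OF T(2) Px] .
  \<comment> \<open>The cosine of the angle at \<open>w = P p x\<close>: the length of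
    \<open>P p x\<close> over that of \<open>J p x\<close>, which equals the length of
    \<open>x\<close>. The bound by 1 comes from Pythagoras for \<open>P p x + F p x\<close>.\<close>
  define c where "c = sqrt (g p (P p x) (P p x)) / sqrt (g p x x)"
  have "g p x x = g p (P p x + F p x) (P p x + F p x)"
    using JJ J_split(3)[OF T(1)] by simp
  also have "\<dots> = g p (P p x) (P p x) + g p (F p x) (F p x)"
    using T K_H[OF J_split(1,2)[OF T(1)]] by (simp add: metric_left metric_right T_intros)
  finally have "g p (P p x) (P p x) \<le> g p x x"
    using metric_nonneg[OF T(3)] by simp
  then have c1: "0 \<le> c" "c \<le> 1"
    unfolding c_def using pos posP by (simp_all add: divide_simps)
  have "arccos c \<in> S"
    unfolding S
  proof (rule image_eqI)
    show "P p x \<in> {w \<in> D p. w \<noteq> 0}" using Px D(3)[OF assms] by simp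
    have "g p (P p x) (P p x) / (sqrt (g p x x) * sqrt (g p (P p x) (P p x)))
        = (g p (P p x) (P p x) / sqrt (g p (P p x) (P p x))) / sqrt (g p x x)"
      by (simp add: ac_simps)
    then show "arccos c = arccos (g p (P p x) (P p x) / (sqrt (g p x x) * sqrt (g p (P p x) (P p x))))"
      unfolding c_def using posP by (simp add: real_div_sqrt)
  qed
  moreover have "arccos c \<le> s" if "s \<in> S" for s
  proof -
    obtain w where w: "w \<in> D p" "w \<noteq> 0" "s = arccos (g p (P p x) w / (sqrt (g p x x) * sqrt (g p w w)))"
      using \<open>s \<in> S\<close> unfolding S by auto
    have wT: "w \<in> tangent_space A p" using w(1) D(2) K_T by blast
    have posw: "g p w w > 0" using metric_pos[OF wT w(2)] .
    have "\<bar>g p (P p x) w / (sqrt (g p x x) * sqrt (g p w w))\<bar> = \<bar>g p (P p x) w\<bar> / (sqrt (g p x x) * sqrt (g p w w))"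
      using pos posw by (simp add: abs_mult)
    also have "\<dots> \<le> sqrt (g p (P p x) (P p x)) * sqrt (g p w w) / (sqrt (g p x x) * sqrt (g p w w))"
      using Cauchy_Schwarz[OF T(2) wT] pos posw by (intro divide_right_mono) auto
    also have "\<dots> = c" unfolding c_def using posw by simp
    finally show ?thesis
      unfolding w(3) using c1 by (intro arccos_le_arccos) (auto simp only: abs_le_iff)
  qed
  ultimately have "Inf S = arccos c" by (rule cInf_eq_minimum)
  then have "cos \<theta> = c" using angle c1 cos_arccos[of c] by simp
  then show ?thesis
    unfolding c_def using pos posP by (simp add: power_divide)
qed

text \<open>Polarization: expand \<open>slant_norm\<close> at \<open>x + y\<close> and cancel its
  instances at \<open>x\<close> and \<open>y\<close>.\<close>

lemma slant_polar:
  assumes "x \<in> D p" "y \<in> D p"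
  shows "g p (P p x) (P p y) = (cos \<theta>)\<^sup>2 * g p x y"
proof -
  have T: "x \<in> tangent_space A p" "P p x \<in> tangent_space A p" "y \<in> tangent_space A p" "P p y \<in> tangent_space A p"
    using assms D K_T by auto
  have "x + y \<in> D p" using assms D(1) by (auto intro: subspace_add)
  from slant_norm[OF this] show ?thesis
    using slant_norm[OF assms(1)] slant_norm[OF assms(2)] T metric_sym[OF T(1,3)] metric_sym[OF T(2,4)]
    by (simp add: P_add metric_left metric_right T_intros algebra_simps)
qed

text \<open>On \<open>D\<close> the map \<open>P\<close> is skew because \<open>J\<close> is, so
  \<open>slant_polar\<close> makes \<open>z\<close> orthogonal to all of \<open>D\<close>, in
  particular to itself; invariance of \<open>D\<close> under \<open>P\<close> puts \<open>z\<close>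
  into \<open>D\<close>.\<close>

lemma P_P:
  assumes x: "x \<in> D p"
  shows "P p (P p x) = - ((cos \<theta>)\<^sup>2 *\<^sub>R x)"
proof -
  define z where "z = P p (P p x) + (cos \<theta>)\<^sup>2 *\<^sub>R x"
  have z: "z \<in> D p"
    unfolding z_def by (intro subspace_add[OF D(1)] subspace_scale[OF D(1)] D(3) x)
  have T: "x \<in> tangent_space A p" "P p x \<in> tangent_space A p" "P p (P p x) \<in> tangent_space A p"
      "z \<in> tangent_space A p" "P p z \<in> tangent_space A p"
      "F p (P p x) \<in> tangent_space A p" "F p z \<in> tangent_space A p"
    using x z D K_T J_split(2) H_T by auto
  have "g p (J p (P p x)) z = g p (P p (P p x)) z"
    using metric_left(1)[OF T(3,6,4)] J_split(3)[OF T(2)] K_H(2)[OF D(2)[OF z] J_split(2)[OF T(2)]] by simp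
  moreover have "g p (P p x) (J p z) = g p (P p x) (P p z)"
    using metric_right(1)[OF T(5,7,2)] J_split(3)[OF T(4)] K_H(1)[OF D(2)[OF D(3)[OF x]] J_split(2)[OF T(4)]] by simp
  ultimately have "g p (P p (P p x)) z = - (cos \<theta>)\<^sup>2 * g p x z"
    using J_skew[OF T(2,4)] slant_polar[OF x z] by simp
  then have "g p z z = 0"
    using metric_left(1)[OF T(3) T_intros(5)[OF T(1)] T(4)] metric_left(4)[OF T(1,4)] by (simp add: z_def)
  then have "z = 0" using metric_eq_0 T(4) by blast
  then show ?thesis unfolding z_def by (simp add: eq_neg_iff_add_eq_0)
qed

text \<open>Compare vertical parts in \<open>J p (J p x) = - x\<close>, with \<open>J p x\<close>
  split into \<open>P p x + F p x\<close>, and insert \<open>P_P\<close>. On horizontal vectors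
  \<open>P\<close> is \<phi>, so this computes \<phi>F.\<close>

lemma P_F:
  assumes x: "x \<in> D p"
  shows "P p (F p x) = - ((sin \<theta>)\<^sup>2 *\<^sub>R x)"
proof -
  have T: "x \<in> tangent_space A p" "P p x \<in> tangent_space A p" "F p x \<in> tangent_space A p"
    using x D K_T J_split(2) H_T by auto
  have "ver p (J p (J p x)) = - x"
    using J_J[OF T(1)] proj_K(1)[OF subspace_neg[OF subspace_K D(2)[OF x]]] by simp
  moreover have "ver p (J p (J p x)) = P p (P p x) + P p (F p x)"
    using P_add[OF T(2,3)] J_split(3)[OF T(1)] by (simp add: J_ver_def)
  ultimately have "P p (F p x) = (cos \<theta>)\<^sup>2 *\<^sub>R x - x"
    using P_P[OF x] by (simp add: algebra_simps)
  also have "\<dots> = - ((sin \<theta>)\<^sup>2 *\<^sub>R x)"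
    by (simp add: cos_squared_eq scaleR_diff_left)
  finally show ?thesis .
qed

end

end

section \<open>Bi-slant submersions\<close>

locale kaehler_submersion = kaehler_distribution A g "vertical A B \<pi>" nabla J
  for A :: "('m::{t2_space,second_countable_topology}, 'e::real_inner) atlas" and g
    and B :: "('n::{t2_space,second_countable_topology}, 'f::real_inner) atlas" and \<pi> nabla J +
  assumes atlas_B: "smooth_atlas B" and continuous_pi: "continuous_on UNIV \<pi>"
begin

section \<open>Vertical vectors and brackets with basic fields\<close>

abbreviation "K \<equiv> vertical A B \<pi>"

text \<open>On functions that are not smooth near \<open>\<pi> p\<close> the pushforward is 0 by
  convention, so only smooth test functions remain.\<close>

lemma vertical_iff:
  "v \<in> K p \<longleftrightarrow> v \<in> tangent_space A p \<and> (\<forall>f. smooth_near B (\<pi> p) f \<longrightarrow> tapp v (f \<circ> \<pi>) = 0)"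
proof -
  have "pushforward B \<pi> p v = 0 \<longleftrightarrow> (\<forall>f. tapp (pushforward B \<pi> p v) f = tapp 0 f)"
    using tvec_eqI by metis
  then show ?thesis by (auto simp: vertical_def pushforward_def)
qed

lemma eventually_pi: "eventually Q (nhds (\<pi> p)) \<Longrightarrow> eventually (\<lambda>q. Q (\<pi> q)) (nhds p)"
proof -
  assume "eventually Q (nhds (\<pi> p))"
  then obtain S where "open S" "\<pi> p \<in> S" "\<And>y. y \<in> S \<Longrightarrow> Q y"
    unfolding eventually_nhds by blast
  moreover from this(1) have "open (\<pi> -` S)"
    using continuous_pi open_vimage by blast
  ultimately show ?thesis
    unfolding eventually_nhds by (intro exI[of _ "\<pi> -` S"]) auto
qed

lemma eventually_smooth_near:
  "smooth_near B y f \<Longrightarrow> eventually (\<lambda>z. smooth_near B z f) (nhds y)"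
  unfolding smooth_near_def eventually_nhds by blast

text \<open>\<open>W\<close> and \<open>X\<close> are \<open>\<pi>\<close>-related to \<open>0\<close> and to the field \<open>Y\<close> on the base, so \<open>[W, X]\<close> is
  \<open>\<pi>\<close>-related to \<open>[0, Y] = 0\<close>.  If \<open>f \<circ> \<pi>\<close> were not smooth, the bracket would vanish on it by the
  convention in its definition, so the chain rule is not needed.\<close>

lemma bracket_vertical_basic:
  assumes U: "open U" "p \<in> U" and W: "section_on A U K W" and X: "basic_on A g B \<pi> U X"
  shows "lie_bracket A W X p \<in> K p"
  unfolding vertical_iff
proof (intro conjI allI impI)
  obtain V Y where V: "open V" "\<pi> ` U \<subseteq> V" "vector_field B V Y"
      "\<And>q. q \<in> U \<Longrightarrow> pushforward B \<pi> q (X q) = Y (\<pi> q)"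
    and Xs: "vector_field A U X"
    using X unfolding basic_on_def section_on_def by blast
  have Ws: "vector_field A U W" "\<And>q. q \<in> U \<Longrightarrow> W q \<in> K q"
    using W unfolding section_on_def by auto
  have near: "vector_field_near A p W" "vector_field_near A p X"
    using vector_field_nearI[OF atlas U] Ws Xs by auto
  have T: "W p \<in> tangent_space A p" "X p \<in> tangent_space A p"
    using vector_field_near_T near by auto
  \<comment> \<open>Tangency of the bracket is read off from torsion-freeness, since both covariant
    derivatives are tangent.\<close>
  have "nabla p (W p) X - nabla p (X p) W \<in> tangent_space A p"
    using nabla_T near T by (intro T_intros)
  then show "lie_bracket A W X p \<in> tangent_space A p"
    using nabla_torsion[OF near] by simp
  have evU: "eventually (\<lambda>q. q \<in> U) (nhds p)"
    using U eventually_nhds by blast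
  fix f assume f: "smooth_near B (\<pi> p) f"
  have evf: "eventually (\<lambda>q. smooth_near B (\<pi> q) f) (nhds p)"
    using eventually_pi[OF eventually_smooth_near[OF f]] .
  show "tapp (lie_bracket A W X p) (f \<circ> \<pi>) = 0"
  proof (cases "smooth_near A p (f \<circ> \<pi>)")
    case False
    then show ?thesis by (simp add: lie_bracket_def)
  next
    case True
    have "eventually (\<lambda>q. tapp (W q) (f \<circ> \<pi>) = 0) (nhds p)"
      using evf evU by eventually_elim (use Ws(2) vertical_iff in blast)
    then have "tapp (X p) (\<lambda>q. tapp (W q) (f \<circ> \<pi>)) = tapp (X p) (\<lambda>q. 0)"
      by (rule tangent_space_cong[OF atlas T(2) smooth_near_tapp[OF atlas Ws(1) U True]])
    then have 1: "tapp (X p) (\<lambda>q. tapp (W q) (f \<circ> \<pi>)) = 0"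
      using tangent_space_zero[OF atlas T(2)] by simp
    define Yf where "Yf y = tapp (Y y) f" for y
    have "eventually (\<lambda>q. tapp (X q) (f \<circ> \<pi>) = (Yf \<circ> \<pi>) q) (nhds p)"
      using evf evU
    proof eventually_elim
      case (elim q)
      have "tapp (pushforward B \<pi> q (X q)) f = tapp (X q) (f \<circ> \<pi>)"
        using elim(1) by (simp add: pushforward_def)
      then show ?case using V(4)[OF elim(2)] by (simp add: Yf_def)
    qed
    then have "tapp (W p) (\<lambda>q. tapp (X q) (f \<circ> \<pi>)) = tapp (W p) (Yf \<circ> \<pi>)"
      by (rule tangent_space_cong[OF atlas T(1) smooth_near_tapp[OF atlas Xs U True]])
    \<comment> \<open>\<open>Yf\<close> is smooth near \<open>\<pi> p\<close> because
      \<open>Y\<close> is a vector field on the open set \<open>V\<close>; hence it is an admissible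
      test function for the vertical vector \<open>W p\<close>.\<close>
    moreover have "smooth_near B (\<pi> p) Yf"
      unfolding Yf_def using smooth_near_tapp[OF atlas_B V(3,1) _ f] V(2) U(2) by blast
    then have "tapp (W p) (Yf \<circ> \<pi>) = 0"
      using Ws(2)[OF U(2)] vertical_iff by blast
    ultimately show ?thesis
      using 1 True by (simp add: lie_bracket_def)
  qed
qed

text \<open>The two derivatives differ by the bracket, which is vertical. With \<open>X\<close> the
  field \<open>FZ\<close>, this is the hypothesis of \<open>hor_nabla_formula\<close>.\<close>

lemma hor_nabla_basic:
  assumes U: "open U" "p \<in> U" and W: "section_on A U K W" and X: "basic_on A g B \<pi> U X"
  shows "hor p (nabla p (X p) W) = hor p (nabla p (W p) X)"
proof -
  have near: "vector_field_near A p W" "vector_field_near A p X"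
    using vector_field_nearI[OF atlas U] W X unfolding basic_on_def section_on_def by auto
  have T: "nabla p (X p) W \<in> tangent_space A p" "nabla p (W p) X \<in> tangent_space A p"
    using nabla_T near vector_field_near_T by auto
  have br: "lie_bracket A W X p \<in> K p"
    using bracket_vertical_basic[OF assms] .
  have "nabla p (W p) X = nabla p (X p) W + lie_bracket A W X p"
    using nabla_torsion[OF near] by (simp add: algebra_simps)
  then show ?thesis
    using proj_add(2)[OF T(1) K_T[OF br]] proj_K(2)[OF br] by simp
qed

text \<open>A basic field \<open>\<xi>\<close> in \<open>FD\<close> equals \<open>FZ\<close> for the vertical field \<open>Z = - \<phi>\<xi> / sin\<^sup>2 \<theta>\<close>, and the
  values of these \<open>Z\<close> span \<open>D\<close>.\<close>

lemma slant_part_orthogonal: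
  assumes D: "\<And>q. subspace (D q)" "\<And>q x. x \<in> D q \<Longrightarrow> x \<in> K q" "\<And>q x. x \<in> D q \<Longrightarrow> P q x \<in> D q"
    and slant: "slant g J D \<theta>" and \<theta>: "0 < \<theta>" "\<theta> < pi / 2"
    and span: "locally_spanned_by_basic A g B \<pi> (\<lambda>q. F q ` D q)"
    and U: "open U" "p \<in> U" and X: "section_on A U K X"
    and N: "vector_field_near A p N" "eventually (\<lambda>q. N q \<in> H q) (nhds p)"
    and nabla_Z: "\<And>V Z. open V \<Longrightarrow> p \<in> V \<Longrightarrow> V \<subseteq> U \<Longrightarrow> section_on A V K Z \<Longrightarrow>
      basic_on A g B \<pi> V (\<lambda>q. F q (Z q)) \<Longrightarrow> hor p (nabla p (X p) Z) = 0"
    and x: "x \<in> D p"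
  shows "g p x (nabla p (X p) N) = 0"
proof -
  define n where "n = nabla p (X p) N"
  define s where "s = (sin \<theta>)\<^sup>2"
  have PF: "P q (F q z) = - ((sin \<theta>)\<^sup>2 *\<^sub>R z)" if "z \<in> D q" for q z
    by (rule P_F[OF D(1) _ _ slant \<theta> that]) (erule D(2,3))+
  have s0: "s \<noteq> 0" unfolding s_def using sin_gt_zero[of \<theta>] \<theta> by simp
  have XT: "X p \<in> tangent_space A p" using section_onD(3)[OF X U] .
  have nT: "n \<in> tangent_space A p" unfolding n_def using nabla_T N(1) XT by blast
  obtain U1 \<Xi> where U1: "open U1" "p \<in> U1" "\<And>\<xi>. \<xi> \<in> \<Xi> \<Longrightarrow> basic_on A g B \<pi> U1 \<xi>"
      "\<And>q. q \<in> U1 \<Longrightarrow> F q ` D q = span ((\<lambda>\<xi>. \<xi> q) ` \<Xi>)"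
    using span unfolding locally_spanned_by_basic_def by metis
  obtain U0 where U0: "open U0" "p \<in> U0" "\<And>V Y. open V \<Longrightarrow> V \<subseteq> U0 \<Longrightarrow> vector_field A V Y \<Longrightarrow>
      vector_field A V (\<lambda>q. ver q (Y q))"
    using smooth_proj[of p] by blast
  \<comment> \<open>\<open>U\<close> is the domain for \<open>nabla_Z\<close>, \<open>U1\<close>
    carries the spanning basic fields, and on \<open>U0\<close> the vertical projection is
    smooth.\<close>
  define V where "V = U \<inter> U1 \<inter> U0"
  have V: "open V" "p \<in> V" "V \<subseteq> U" "V \<subseteq> U1" "V \<subseteq> U0"
    unfolding V_def using U U1 U0 by auto
  have generator: "\<xi> p \<in> tangent_space A p \<and> g p (P p (\<xi> p)) n = 0" if \<xi>: "\<xi> \<in> \<Xi>" for \<xi>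
  proof -
    have basic: "basic_on A g B \<pi> U1 \<xi>" using U1(3)[OF \<xi>] .
    \<comment> \<open>If \<open>\<xi> q = F q z\<close> with \<open>z\<close> in \<open>D q\<close>,
      then \<open>P_F\<close> turns \<open>P q (\<xi> q)\<close> into \<open>- s\<close> times
      \<open>z\<close>, so this field picks out \<open>z\<close> itself.\<close>
    define Z where "Z q = (- inverse s) *\<^sub>R P q (\<xi> q)" for q
    have Z: "Z q \<in> K q \<and> F q (Z q) = \<xi> q" if "q \<in> V" for q
    proof -
      have "\<xi> q \<in> F q ` D q"
        using U1(4)[of q] V(4) that \<xi> by (auto intro: span_base)
      then obtain z where z: "z \<in> D q" "\<xi> q = F q z" by blast
      then have "Z q = z"
        using PF[OF z(1)] s0 by (simp add: Z_def flip: s_def)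
      then show ?thesis using z D(2) by simp
    qed
    have \<xi>V: "vector_field A V \<xi>"
      using basic vector_field_mono[OF atlas _ V(4)] unfolding basic_on_def section_on_def by blast
    have "vector_field A V (\<lambda>q. P q (\<xi> q))"
      unfolding J_ver_def by (rule U0(3)[OF V(1,5) J_vector_field[OF V(1) \<xi>V]])
    then have "vector_field A V Z"
      unfolding Z_def by (intro vector_field_scale[OF atlas]) auto
    then have sZ: "section_on A V K Z"
      using Z unfolding section_on_def by blast
    have FZ: "vector_field A V (\<lambda>q. F q (Z q))"
      by (rule vector_field_cong[OF atlas \<xi>V]) (simp add: Z)
    obtain V' Y where Y: "open V'" "\<pi> ` U1 \<subseteq> V'" "vector_field B V' Y"
        "\<And>q. q \<in> U1 \<Longrightarrow> pushforward B \<pi> q (\<xi> q) = Y (\<pi> q)" "\<And>q. q \<in> U1 \<Longrightarrow> \<xi> q \<in> H q"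
      using basic unfolding basic_on_def section_on_def by blast
    have "\<pi> ` V \<subseteq> V'" using image_mono[OF V(4)] Y(2) by (rule order_trans)
    then have "basic_on A g B \<pi> V (\<lambda>q. F q (Z q))"
      unfolding basic_on_def section_on_def using FZ Y Z subsetD[OF V(4)]
      by (intro conjI exI[of _ V'] exI[of _ Y]) auto
    then have 0: "hor p (nabla p (X p) Z) = 0"
      using nabla_Z[OF V(1,2,3) sZ] by blast
    note Zp = section_onD[OF sZ V(1,2)]
    have NT: "N p \<in> H p" using eventually_nhds_x_imp_x[OF N(2)] .
    have nZ: "nabla p (X p) Z \<in> tangent_space A p" using nabla_T Zp(1) XT by blast
    have "nabla p (X p) Z \<in> K p"
      using ver_hor[OF nZ] ver_K[OF nZ] 0 by simp
    then have "g p (nabla p (X p) Z) (N p) = 0" using K_H(1) NT by blast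
    moreover have "eventually (\<lambda>q. g q (Z q) (N q) = 0) (nhds p)"
      using Zp(4) N(2) by eventually_elim (rule K_H(1))
    ultimately have "g p (Z p) n = 0"
      using nabla_orthogonal[OF Zp(1) N(1) XT] unfolding n_def by simp
    moreover have \<xi>T: "\<xi> p \<in> tangent_space A p"
      using vector_field_tangent[OF atlas \<xi>V V(2)] .
    moreover have "P p (\<xi> p) \<in> tangent_space A p" using J_split(1)[OF \<xi>T] K_T by blast
    ultimately show ?thesis
      using s0 nT metric_left(4)[of "P p (\<xi> p)" p n "- inverse s"] unfolding Z_def by simp
  qed
  have PT: "P p u \<in> tangent_space A p" if "u \<in> tangent_space A p" for u
    using J_split(1)[OF that] K_T by blast
  \<comment> \<open>Orthogonality of \<open>P p u\<close> to \<open>n\<close> is linear in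
    \<open>u\<close>, so it extends from the generators to \<open>F p x\<close>, where
    \<open>P_F\<close> returns a nonzero multiple of \<open>x\<close>.\<close>
  have "span ((\<lambda>\<xi>. \<xi> p) ` \<Xi>) \<subseteq> {u \<in> tangent_space A p. g p (P p u) n = 0}"
  proof (rule span_minimal)
    show "(\<lambda>\<xi>. \<xi> p) ` \<Xi> \<subseteq> {u \<in> tangent_space A p. g p (P p u) n = 0}"
      using generator by blast
    have "P p 0 = 0" using P_scale[of 0 p 0] T_intros(1) by simp
    then show "subspace {u \<in> tangent_space A p. g p (P p u) n = 0}"
      unfolding subspace_def using nT PT
      by (auto intro!: T_intros simp: metric_left P_add P_scale)
  qed
  then have "g p (P p (F p x)) n = 0"
    using U1(4)[OF U1(2)] x by blast
  then have "s * g p x n = 0"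
    using PF[OF x] metric_left(3,4) nT K_T[OF D(2)[OF x]] by (simp add: T_intros s_def)
  then show ?thesis using s0 by (simp add: n_def)
qed

end

theorem theorem3p12:
  fixes A :: "('m::{t2_space,second_countable_topology}, 'e::real_inner) atlas"
    and B :: "('n::{t2_space,second_countable_topology}, 'f::real_inner) atlas"
    and g :: "'m metric_tensor" and gN :: "'n metric_tensor"
    and nabla :: "'m connection" and J :: "'m \<Rightarrow> 'm tvec \<Rightarrow> 'm tvec"
    and \<pi> :: "'m \<Rightarrow> 'n"
    and D1 D2 :: "'m \<Rightarrow> 'm tvec set" and \<theta>1 \<theta>2 :: real
  assumes "riemannian_manifold A g" and "levi_civita A g nabla" and "kaehler A g nabla J"
    and "riemannian_manifold B gN"
    and "riemannian_submersion A g B gN \<pi>"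
    and "bi_slant A g J (vertical A B \<pi>) D1 \<theta>1 D2 \<theta>2"
    and "0 < \<theta>1" "\<theta>1 < pi / 2" "0 < \<theta>2" "\<theta>2 < pi / 2"
    and "locally_spanned_by_basic A g B \<pi> (\<lambda>p. J_hor A g (vertical A B \<pi>) J p ` D1 p)"
    and "locally_spanned_by_basic A g B \<pi> (\<lambda>p. J_hor A g (vertical A B \<pi>) J p ` D2 p)"
  shows "totally_geodesic_foliation A nabla (vertical A B \<pi>) \<longleftrightarrow>
    (let K = vertical A B \<pi>;
         P = J_ver g K J; F = J_hor A g K J; \<omega> = J_hor A g K J;
         \<T> = oneill_T A g nabla K; \<A> = oneill_A A g nabla K
     in \<forall>U W Z. open U \<and> section_on A U K W \<and> section_on A U K Z \<and>
          basic_on A g B \<pi> U (\<lambda>q. F q (Z q)) \<longrightarrow>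
          (\<forall>p\<in>U.
             \<omega> p (\<T> W (\<lambda>q. P q (Z q)) p + \<A> (\<lambda>q. F q (Z q)) W p) +
             F p (nabla_hat g nabla K W (\<lambda>q. P q (Z q)) p + \<T> W (\<lambda>q. F q (Z q)) p) = 0))"
proof -
  interpret riemannian A g using assms(1) by unfold_locales
  have dist: "distribution A D1" "distribution A D2"
    and K_sum: "\<And>p. vertical A B \<pi> p = {x + y |x y. x \<in> D1 p \<and> y \<in> D2 p}"
    and orth: "\<And>p x y. x \<in> D1 p \<Longrightarrow> y \<in> D2 p \<Longrightarrow> g p x y = 0"
    and slant: "slant g J D1 \<theta>1" "slant g J D2 \<theta>2"
    and P_D: "\<And>p x. x \<in> D1 p \<Longrightarrow> J_ver g (vertical A B \<pi>) J p x \<in> D1 p"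
      "\<And>p x. x \<in> D2 p \<Longrightarrow> J_ver g (vertical A B \<pi>) J p x \<in> D2 p"
    using assms(6) unfolding bi_slant_def by blast+
  have sub: "subspace (D1 p)" "subspace (D2 p)" for p
    using smooth_orth_proj_distribution[OF dist(1), of p] smooth_orth_proj_distribution[OF dist(2), of p]
      smooth_orth_projD(1) by blast+
  interpret kaehler_submersion A g B \<pi> nabla J
  proof unfold_locales
    fix p
    obtain U1 pr1 where 1: "open U1" "p \<in> U1" "smooth_orth_proj U1 D1 pr1"
      using smooth_orth_proj_distribution[OF dist(1)] by blast
    obtain U2 pr2 where 2: "open U2" "p \<in> U2" "smooth_orth_proj U2 D2 pr2"
      using smooth_orth_proj_distribution[OF dist(2)] by blast
    have "smooth_orth_proj (U1 \<inter> U2) (vertical A B \<pi>) (\<lambda>q e. pr1 q e + pr2 q e)"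
      by (rule smooth_orth_proj_sum[OF smooth_orth_proj_mono[OF 1(3)] smooth_orth_proj_mono[OF 2(3)] K_sum orth])
        auto
    then show "\<exists>U pr. open U \<and> p \<in> U \<and> smooth_orth_proj U (vertical A B \<pi>) pr"
      using 1(1,2) 2(1,2) by (intro exI[of _ "U1 \<inter> U2"]) auto
    show "smooth_atlas B" using assms(4) unfolding riemannian_manifold_def by blast
    show "continuous_on UNIV \<pi>"
      using assms(5) unfolding riemannian_submersion_def smooth_map_def by blast
  qed (use assms(2,3) in auto)
  have D_K: "x \<in> D1 p \<Longrightarrow> x \<in> K p" "x \<in> D2 p \<Longrightarrow> x \<in> K p" for x p
    unfolding K_sum using subspace_0[OF sub(1), of p] subspace_0[OF sub(2), of p]
    by (force intro: exI[of _ 0])+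
  \<comment> \<open>The O'Neill expression is minus the horizontal derivative, so the two vanish
    together.\<close>
  have formula: "hor p (nabla p (W p) Z) = 0 \<longleftrightarrow>
      F p (oneill_T A g nabla K W (\<lambda>q. P q (Z q)) p + oneill_A A g nabla K (\<lambda>q. F q (Z q)) W p) +
      F p (nabla_hat g nabla K W (\<lambda>q. P q (Z q)) p + oneill_T A g nabla K W (\<lambda>q. F q (Z q)) p) = 0"
    if "open U \<and> section_on A U K W \<and> section_on A U K Z \<and> basic_on A g B \<pi> U (\<lambda>q. F q (Z q))" "p \<in> U"
    for U W Z p
    using that hor_nabla_formula[of U p W Z] hor_nabla_basic[of U p W "\<lambda>q. F q (Z q)"] by simp
  have "totally_geodesic_foliation A nabla K \<longleftrightarrow>
      (\<forall>U W Z. open U \<and> section_on A U K W \<and> section_on A U K Z \<and> basic_on A g B \<pi> U (\<lambda>q. F q (Z q)) \<longrightarrow>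
        (\<forall>p\<in>U. hor p (nabla p (W p) Z) = 0))" (is "?L \<longleftrightarrow> ?R")
  proof
    assume ?L
    then show ?R unfolding totally_geodesic_foliation_def using proj_K(2) by blast
  next
    assume R: ?R
    show ?L
      unfolding totally_geodesic_foliation_def
    proof (intro allI impI ballI)
      fix U X Y p
      assume a: "open U \<and> section_on A U K X \<and> section_on A U K Y" and p: "p \<in> U"
      then have U: "open U" and X: "section_on A U K X" and Y: "section_on A U K Y" by auto
      note Xp = section_onD[OF X U p] and Yp = section_onD[OF Y U p]
      \<comment> \<open>The horizontal part is kept as a field near \<open>p\<close>, not only as a
        vector at \<open>p\<close>, so that it can be differentiated.\<close>
      define N where "N q = hor q (nabla q (X q) Y)" for q
      have XY: "vector_field A U (\<lambda>q. nabla q (X q) Y)"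
        using nabla_vector_field[OF U] X Y unfolding section_on_def by blast
      have N: "vector_field_near A p N"
        unfolding N_def by (rule vector_field_near_proj(2)[OF vector_field_nearI[OF atlas U p XY]])
      have NH: "eventually (\<lambda>q. N q \<in> H q) (nhds p)"
        unfolding N_def eventually_nhds
        using U p hor_H[OF vector_field_tangent[OF atlas XY]] by blast
      have T: "nabla p (X p) Y \<in> tangent_space A p" "nabla p (X p) N \<in> tangent_space A p"
        using nabla_T Yp N Xp by auto
      \<comment> \<open>\<open>Z\<close> may live on a smaller set than \<open>X\<close>, so
        \<open>X\<close> is restricted to \<open>V\<close> before \<open>R\<close> applies.\<close>
      have NZ: "hor p (nabla p (X p) Z) = 0"
        if "open V" "p \<in> V" "V \<subseteq> U" "section_on A V K Z" "basic_on A g B \<pi> V (\<lambda>q. F q (Z q))" for V Z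
      proof -
        have "section_on A V K X"
          using X that(3) vector_field_mono[OF atlas _ that(3)] unfolding section_on_def by blast
        then show ?thesis using R that by blast
      qed
      \<comment> \<open>Only the value of \<open>Y\<close> at \<open>p\<close> enters the remaining
        inner product, so splitting this one vector suffices.\<close>
      obtain y1 y2 where y: "Y p = y1 + y2" "y1 \<in> D1 p" "y2 \<in> D2 p"
        using Yp(2) unfolding K_sum by blast
      have "g p y1 (nabla p (X p) N) = 0"
        by (rule slant_part_orthogonal[OF sub(1) _ _ slant(1) assms(7,8,11) U p X N NH _ y(2)])
          (erule D_K(1) P_D(1) NZ; assumption)+
      moreover have "g p y2 (nabla p (X p) N) = 0"
        by (rule slant_part_orthogonal[OF sub(2) _ _ slant(2) assms(9,10,12) U p X N NH _ y(3)])
          (erule D_K(2) P_D(2) NZ; assumption)+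
      ultimately have "g p (Y p) (nabla p (X p) N) = 0"
        using y T K_T D_K by (simp add: metric_left)
      moreover have "eventually (\<lambda>q. g q (Y q) (N q) = 0) (nhds p)"
        using Yp(4) NH by eventually_elim (rule K_H(1))
      ultimately have "g p (nabla p (X p) Y) (N p) = 0"
        using nabla_orthogonal[OF Yp(1) N Xp(3)] by simp
      \<comment> \<open>The vertical part contributes nothing against \<open>N p\<close>, so the
        vanishing product is the squared length of \<open>N p\<close>.\<close>
      moreover have "g p (nabla p (X p) Y) (N p) = g p (ver p (nabla p (X p) Y) + N p) (N p)"
        unfolding N_def using ver_hor[OF T(1)] by simp
      moreover have "\<dots> = g p (N p) (N p)"
        using metric_left(1)[OF proj_T(1)[OF T(1)] proj_T(2)[OF T(1)] proj_T(2)[OF T(1)]]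
          K_H(1)[OF ver_K[OF T(1)] hor_H[OF T(1)]] by (simp add: N_def)
      ultimately have "N p = 0"
        using metric_eq_0 proj_T(2)[OF T(1)] by (simp add: N_def)
      then show "nabla p (X p) Y \<in> K p"
        using ver_hor[OF T(1)] ver_K[OF T(1)] by (simp add: N_def)
    qed
  qed
  also have "\<dots> \<longleftrightarrow> (\<forall>U W Z. open U \<and> section_on A U K W \<and> section_on A U K Z \<and>
      basic_on A g B \<pi> U (\<lambda>q. F q (Z q)) \<longrightarrow> (\<forall>p\<in>U.
        F p (oneill_T A g nabla K W (\<lambda>q. P q (Z q)) p + oneill_A A g nabla K (\<lambda>q. F q (Z q)) W p) +
        F p (nabla_hat g nabla K W (\<lambda>q. P q (Z q)) p + oneill_T A g nabla K W (\<lambda>q. F q (Z q)) p) = 0))"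
    by (intro all_cong1 imp_cong ball_cong refl formula)
  finally show ?thesis unfolding Let_def .
qed

end
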